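(* For every $n\ge1$ the point functor $P_l^{(n)}$ is invariant under isomorphism: for all graphs $E,F$ and every ring isomorphism $f\colon L_K(E)\to L_K(F)$ one has $f\big(I(P_l^{(n)}(E))\big)=I(P_l^{(n)}(F))$.
   Context: Graphs are directed graphs $E=(E^0,E^1,r,s)$, assumed row-finite ($s^{-1}(v)$ finite for all $v$). $K$ is a field. $L_K(E)$ is the Leavitt path algebra: the $K$-algebra generated by $E^0\cup E^1\cup\{e^*: e\in E^1\}$ with relations $vw=\delta_{v,w}v$, $s(e)e=e=e\,r(e)$, $r(e)e^*=e^*=e^*s(e)$, $e^*f=\delta_{e,f}r(e)$, and $v=\sum_{s(e)=v}ee^*$ for each regular vertex $v$ ($0<|s^{-1}(v)|<\infty$). $I(X)$ is the two-sided ideal of $L_K(E)$ generated by $X\subseteq E^0$. A set $X\subseteq E^0$ is hereditary if whenever $v\in X$ and there is a path from $v$ to $w$, then $w\in X$; it is saturated if every regular vertex $v$ with $r(s^{-1}(v))\subseteq X$ lies in $X$. For an algebra $A$, the socle series is $\mathrm{Soc}^{(1)}(A)=\mathrm{Soc}(A)$ and $\mathrm{Soc}^{(n+1)}(A)$ is the ideal containing $\mathrm{Soc}^{(n)}(A)$ with $\mathrm{Soc}^{(n+1)}(A)/\mathrm{Soc}^{(n)}(A)=\mathrm{Soc}\big(A/\mathrm{Soc}^{(n)}(A)\big)$. For $A=L_K(E)$ each $\mathrm{Soc}^{(n)}(A)$ is a graded ideal (known), hence is of the form $I(P_l^{(n)}(E))$ for a unique hereditary and saturated set $P_l^{(n)}(E)\subseteq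 E^0$, namely $P_l^{(n)}(E)=E^0\cap\mathrm{Soc}^{(n)}(L_K(E))$; this defines the functor $P_l^{(n)}$ from the category of graphs (morphisms: graph isomorphisms) to sets. $P_l^{(1)}(E)$ is the hereditary and saturated closure of the set of line points of $E$ (vertices $v$ such that no vertex reachable from $v$ is a bifurcation, i.e. emits at least two edges, or lies on a cycle). *)

theory Defs
  imports
    "HOL-Library.Poly_Mapping"
    "HOL-Algebra.Congruence"
    "Graph_Theory.Digraph"
begin

section \<open>Algebras without unit\<close>

text \<open>
  The rings of HOL-Algebra are unital, whereas a Leavitt path algebra has a unit only if the
  graph has finitely many vertices.  The type \<open>'k\<close> is the field of scalars.
\<close>

record ('k, 'a) nu_algebra = "'a partial_object" +
  alg_zero :: 'a
  alg_add :: "'a \<Rightarrow> 'a \<Rightarrow> 'a"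
  alg_mult :: "'a \<Rightarrow> 'a \<Rightarrow> 'a"
  alg_smult :: "'k \<Rightarrow> 'a \<Rightarrow> 'a"

definition alg_subspace :: "('k, 'a) nu_algebra \<Rightarrow> 'a set \<Rightarrow> bool" where
  "alg_subspace A I \<longleftrightarrow> I \<subseteq> carrier A \<and> alg_zero A \<in> I \<and>
     (\<forall>x\<in>I. \<forall>y\<in>I. alg_add A x y \<in> I) \<and> (\<forall>c. \<forall>x\<in>I. alg_smult A c x \<in> I)"

definition alg_left_ideal :: "('k, 'a) nu_algebra \<Rightarrow> 'a set \<Rightarrow> bool" where
  "alg_left_ideal A I \<longleftrightarrow> alg_subspace A I \<and> (\<forall>a\<in>carrier A. \<forall>x\<in>I. alg_mult A a x \<in> I)"

definition alg_ideal :: "('k, 'a) nu_algebra \<Rightarrow> 'a set \<Rightarrow> bool" where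
  "alg_ideal A I \<longleftrightarrow> alg_left_ideal A I \<and> (\<forall>a\<in>carrier A. \<forall>x\<in>I. alg_mult A x a \<in> I)"

definition alg_left_ideal_gen :: "('k, 'a) nu_algebra \<Rightarrow> 'a set \<Rightarrow> 'a set" where
  "alg_left_ideal_gen A X = \<Inter>{I. alg_left_ideal A I \<and> X \<subseteq> I}"

definition alg_ideal_gen :: "('k, 'a) nu_algebra \<Rightarrow> 'a set \<Rightarrow> 'a set" where
  "alg_ideal_gen A X = \<Inter>{I. alg_ideal A I \<and> X \<subseteq> I}"

definition alg_coset :: "('k, 'a) nu_algebra \<Rightarrow> 'a set \<Rightarrow> 'a \<Rightarrow> 'a set" where
  "alg_coset A I x = alg_add A x ` I"

text \<open>
  In the operations below, the sets united are all equal when \<open>I\<close> is a two-sided ideal of the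
  algebra \<open>A\<close>.
\<close>

definition alg_quot :: "('k, 'a) nu_algebra \<Rightarrow> 'a set \<Rightarrow> ('k, 'a set) nu_algebra" where
  "alg_quot A I =
    \<lparr> carrier = alg_coset A I ` carrier A,
      alg_zero = alg_coset A I (alg_zero A),
      alg_add = (\<lambda>X Y. \<Union>x\<in>X. \<Union>y\<in>Y. alg_coset A I (alg_add A x y)),
      alg_mult = (\<lambda>X Y. \<Union>x\<in>X. \<Union>y\<in>Y. alg_coset A I (alg_mult A x y)),
      alg_smult = (\<lambda>c X. \<Union>x\<in>X. alg_coset A I (alg_smult A c x)) \<rparr>"

text \<open>Ring isomorphisms are not required to be linear over the scalars.\<close>

definition alg_ring_iso :: "('k, 'a) nu_algebra \<Rightarrow> ('k, 'b) nu_algebra \<Rightarrow> ('a \<Rightarrow> 'b) set" where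
  "alg_ring_iso A B = {f. bij_betw f (carrier A) (carrier B) \<and>
     (\<forall>x\<in>carrier A. \<forall>y\<in>carrier A. f (alg_add A x y) = alg_add B (f x) (f y)) \<and>
     (\<forall>x\<in>carrier A. \<forall>y\<in>carrier A. f (alg_mult A x y) = alg_mult B (f x) (f y))}"


section \<open>The socle series\<close>

definition minimal_left_ideal :: "('k, 'a) nu_algebra \<Rightarrow> 'a set \<Rightarrow> bool" where
  "minimal_left_ideal A M \<longleftrightarrow> alg_left_ideal A M \<and> M \<noteq> {alg_zero A} \<and>
     (\<forall>N. alg_left_ideal A N \<and> N \<subseteq> M \<longrightarrow> N = {alg_zero A} \<or> N = M)"

text \<open>
  The socle is the sum of all minimal left ideals, that is, the smallest left ideal containing
  them; it is the zero ideal if there are none.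
\<close>

definition socle :: "('k, 'a) nu_algebra \<Rightarrow> 'a set" where
  "socle A = alg_left_ideal_gen A (\<Union>{M. minimal_left_ideal A M})"

fun socle_series :: "('k, 'a) nu_algebra \<Rightarrow> nat \<Rightarrow> 'a set" where
  "socle_series A 0 = {alg_zero A}"
| "socle_series A (Suc 0) = socle A"
| "socle_series A (Suc (Suc n)) =
     {x \<in> carrier A. alg_coset A (socle_series A (Suc n)) x
                      \<in> socle (alg_quot A (socle_series A (Suc n)))}"


section \<open>Free algebras\<close>

text \<open>
  Words form the free monoid, written additively so that the product of \<^typ>\<open>'b \<Rightarrow>\<^sub>0 'k\<close> is the
  convolution product of the monoid algebra.
\<close>

datatype 'g gen_word = Word (letters: "'g list")

instantiation gen_word :: (type) monoid_add
begin

definition zero_gen_word :: "'a gen_word" where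
  "0 = Word []"

definition plus_gen_word :: "'a gen_word \<Rightarrow> 'a gen_word \<Rightarrow> 'a gen_word" where
  "u + w = Word (letters u @ letters w)"

instance
  by intro_classes (simp_all add: zero_gen_word_def plus_gen_word_def)

end

text \<open>
  The free associative algebra without unit on a set of generators: the linear combinations of
  nonempty words.
\<close>

definition free_algebra :: "'g set \<Rightarrow> ('k::field, 'g gen_word \<Rightarrow>\<^sub>0 'k) nu_algebra" where
  "free_algebra X =
    \<lparr> carrier = {p. \<forall>w\<in>Poly_Mapping.keys p. letters w \<noteq> [] \<and> set (letters w) \<subseteq> X},
      alg_zero = 0,
      alg_add = (+),
      alg_mult = (*),
      alg_smult = (\<lambda>c p. Poly_Mapping.single 0 c * p) \<rparr>"

definition free_gen :: "'g \<Rightarrow> ('g gen_word \<Rightarrow>\<^sub>0 'k::field)" where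
  "free_gen g = Poly_Mapping.single (Word [g]) 1"


section \<open>Leavitt path algebras\<close>

text \<open>
  The source and range maps are \<^const>\<open>tail\<close> and \<^const>\<open>head\<close>; loops, parallel edges and infinite
  graphs are allowed.
\<close>

locale row_finite_digraph = wf_digraph +
  assumes finite_out_arcs: "v \<in> verts G \<Longrightarrow> finite (out_arcs G v)"

definition regular_vertex :: "('v, 'e) pre_digraph \<Rightarrow> 'v \<Rightarrow> bool" where
  "regular_vertex E v \<longleftrightarrow> v \<in> verts E \<and> out_arcs E v \<noteq> {} \<and> finite (out_arcs E v)"

datatype ('v, 'e) lpa_gen = Vertex 'v | Edge 'e | Ghost 'e

definition lpa_gens :: "('v, 'e) pre_digraph \<Rightarrow> ('v, 'e) lpa_gen set" where
  "lpa_gens E = Vertex ` verts E \<union> Edge ` arcs E \<union> Ghost ` arcs E"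

text \<open>A relation \<open>a = b\<close> is represented by the element \<open>a - b\<close> of the free algebra.\<close>

inductive_set lpa_relators ::
    "('v, 'e) pre_digraph \<Rightarrow> (('v, 'e) lpa_gen gen_word \<Rightarrow>\<^sub>0 'k::field) set"
  for E :: "('v, 'e) pre_digraph" where
  vertices: "\<lbrakk>v \<in> verts E; w \<in> verts E\<rbrakk> \<Longrightarrow>
    free_gen (Vertex v) * free_gen (Vertex w) - (if v = w then free_gen (Vertex v) else 0)
      \<in> lpa_relators E"
| source_edge: "e \<in> arcs E \<Longrightarrow>
    free_gen (Vertex (tail E e)) * free_gen (Edge e) - free_gen (Edge e) \<in> lpa_relators E"
| edge_range: "e \<in> arcs E \<Longrightarrow>
    free_gen (Edge e) * free_gen (Vertex (head E e)) - free_gen (Edge e) \<in> lpa_relators E"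
| range_ghost: "e \<in> arcs E \<Longrightarrow>
    free_gen (Vertex (head E e)) * free_gen (Ghost e) - free_gen (Ghost e) \<in> lpa_relators E"
| ghost_source: "e \<in> arcs E \<Longrightarrow>
    free_gen (Ghost e) * free_gen (Vertex (tail E e)) - free_gen (Ghost e) \<in> lpa_relators E"
| CK1: "\<lbrakk>e \<in> arcs E; f \<in> arcs E\<rbrakk> \<Longrightarrow>
    free_gen (Ghost e) * free_gen (Edge f)
      - (if e = f then free_gen (Vertex (head E e)) else 0) \<in> lpa_relators E"
| CK2: "regular_vertex E v \<Longrightarrow>
    free_gen (Vertex v) - (\<Sum>e\<in>out_arcs E v. free_gen (Edge e) * free_gen (Ghost e))
      \<in> lpa_relators E"

definition lpa_relation_ideal ::
    "('v, 'e) pre_digraph \<Rightarrow> (('v, 'e) lpa_gen gen_word \<Rightarrow>\<^sub>0 'k::field) set" where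
  "lpa_relation_ideal E = alg_ideal_gen (free_algebra (lpa_gens E)) (lpa_relators E)"

type_synonym ('k, 'v, 'e) lpa_elem = "(('v, 'e) lpa_gen gen_word \<Rightarrow>\<^sub>0 'k) set"

definition leavitt ::
    "('v, 'e) pre_digraph \<Rightarrow> ('k::field, ('k, 'v, 'e) lpa_elem) nu_algebra" where
  "leavitt E = alg_quot (free_algebra (lpa_gens E)) (lpa_relation_ideal E)"

definition lpa_vertex :: "('v, 'e) pre_digraph \<Rightarrow> 'v \<Rightarrow> ('k::field, 'v, 'e) lpa_elem" where
  "lpa_vertex E v =
     alg_coset (free_algebra (lpa_gens E)) (lpa_relation_ideal E) (free_gen (Vertex v))"

definition vertex_ideal ::
    "('v, 'e) pre_digraph \<Rightarrow> 'v set \<Rightarrow> ('k::field, 'v, 'e) lpa_elem set" where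
  "vertex_ideal E X = alg_ideal_gen (leavitt E) (lpa_vertex E ` X)"

text \<open>
  The set \<open>P\<^sub>l\<^bsup>(n)\<^esup>(E)\<close>.  The type argument names the field, which does not occur in
  the type of the result.
\<close>

definition socle_points ::
    "'k::field itself \<Rightarrow> nat \<Rightarrow> ('v, 'e) pre_digraph \<Rightarrow> 'v set" where
  "socle_points _ n E = {v \<in> verts E.
     (lpa_vertex E v :: ('k, 'v, 'e) lpa_elem) \<in> socle_series (leavitt E) n}"

end

(*
  A minimal left ideal of an algebra A modulo an ideal I is described by a generator x: x is not in
  I, and whenever a x is not in I, some b a x is congruent to x.  The socle of A/I pulls back to the
  sums of elements of I and of such x, a description in terms of the ring structure alone.  As
  Leavitt path algebras have local units, the socle series is therefore preserved by ring
  isomorphisms, and it remains to see that each of its terms is generated by the vertices it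
  contains.

  An ideal generated by vertices is graded, so by induction let T be a graded ideal and x minimal
  modulo T.  Multiplying x by a long walk on the right and by a ghost walk on the left turns it into
  k v + (closed walks at v of positive length), with v a vertex outside T.  If one of these walks, g,
  satisfies g g* = v modulo T, then (v - g) x still generates x, and comparing components of lowest
  and highest degree gives a contradiction.  Otherwise g has an exit, and conjugating by it kills g.
  Hence a x b = w modulo T for some vertex w outside T; then w lies in the next term of the socle
  series, and by minimality x lies in the ideal generated by T and w.
*)

theory Submission
  imports Defs "Graph_Theory.Arc_Walk"
begin

section \<open>Minimality modulo an ideal\<close>

text \<open>A ring isomorphism need respect neither scalars nor the grading, while
  \<open>socle\<close> is defined through subspaces; hence the transport has to speak of addition
  and multiplication only, and degrees are used on each side separately, to identify socle terms
  with vertex ideals.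

  That identification is calculated in the free algebra, modulo the preimage \<open>T\<close> of the
  ideal in question. There the degree is read off words, and a graded ideal is one closed under
  homogeneous components. A vertex in \<open>T\<close> counts as zero, which takes the place of a
  quotient graph; non-vanishing is decided by degrees and membership in \<open>T\<close>.

  The long walk serves to absorb the ghost edges in the words of \<open>x\<close>, and
  \<open>CK2\<close> provides one whose product with \<open>x\<close> stays outside
  \<open>T\<close>. If \<open>g\<close> has no exit, it is invertible in the corner at
  \<open>v\<close>, and \<open>v - g\<close> behaves like \<open>1 - t\<close> among Laurent
  polynomials, which has no inverse. Minimality would provide a left inverse once \<open>x\<close>
  is cancelled on the right; this cancellation is possible because the lowest component of
  \<open>x\<close> is a nonzero multiple of \<open>v\<close>.\<close>

definition minimal_mod :: "('k, 'a) nu_algebra \<Rightarrow> 'a set \<Rightarrow> 'a set" where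
  "minimal_mod A I = {x \<in> carrier A. x \<notin> I \<and>
     (\<forall>a\<in>carrier A. alg_mult A a x \<notin> I \<longrightarrow>
       (\<exists>b\<in>carrier A. \<exists>i\<in>I. alg_add A (alg_mult A b (alg_mult A a x)) i = x))}"

text \<open>Finite sums without scalars or negatives, so that additive maps preserving zero carry
  them along. Closure under scalars comes from the summands, by
  \<open>smult_minimal_mod\<close>.\<close>

inductive_set alg_sums :: "('k, 'a) nu_algebra \<Rightarrow> 'a set \<Rightarrow> 'a set"
  for A :: "('k, 'a) nu_algebra" and X :: "'a set" where
  zero: "alg_zero A \<in> alg_sums A X"
| add: "x \<in> X \<Longrightarrow> y \<in> alg_sums A X \<Longrightarrow> alg_add A x y \<in> alg_sums A X"

definition socle_step :: "('k, 'a) nu_algebra \<Rightarrow> 'a set \<Rightarrow> 'a set" where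
  "socle_step A I = alg_sums A (I \<union> minimal_mod A I)"

text \<open>Scalars are left out on purpose, with two independent scalar types: the notion covers
  coset maps as well as ring isomorphisms that are not linear.\<close>

definition ring_epi :: "('k, 'a) nu_algebra \<Rightarrow> ('l, 'b) nu_algebra \<Rightarrow> ('a \<Rightarrow> 'b) \<Rightarrow> bool" where
  "ring_epi A B \<phi> \<longleftrightarrow> \<phi> ` carrier A = carrier B \<and>
     (\<forall>x\<in>carrier A. \<forall>y\<in>carrier A. \<phi> (alg_add A x y) = alg_add B (\<phi> x) (\<phi> y)) \<and>
     (\<forall>x\<in>carrier A. \<forall>y\<in>carrier A. \<phi> (alg_mult A x y) = alg_mult B (\<phi> x) (\<phi> y))"

lemma alg_ideal_iff:
  "alg_ideal A I \<longleftrightarrow> I \<subseteq> carrier A \<and> alg_zero A \<in> I \<and>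
     (\<forall>x\<in>I. \<forall>y\<in>I. alg_add A x y \<in> I) \<and> (\<forall>c. \<forall>x\<in>I. alg_smult A c x \<in> I) \<and>
     (\<forall>a\<in>carrier A. \<forall>x\<in>I. alg_mult A a x \<in> I) \<and> (\<forall>a\<in>carrier A. \<forall>x\<in>I. alg_mult A x a \<in> I)"
  by (auto simp: alg_ideal_def alg_left_ideal_def alg_subspace_def)

lemma alg_left_ideal_iff:
  "alg_left_ideal A I \<longleftrightarrow> I \<subseteq> carrier A \<and> alg_zero A \<in> I \<and>
     (\<forall>x\<in>I. \<forall>y\<in>I. alg_add A x y \<in> I) \<and> (\<forall>c. \<forall>x\<in>I. alg_smult A c x \<in> I) \<and>
     (\<forall>a\<in>carrier A. \<forall>x\<in>I. alg_mult A a x \<in> I)"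
  by (auto simp: alg_left_ideal_def alg_subspace_def)

lemma alg_sums_subset_left_ideal: "\<lbrakk>alg_left_ideal A I; X \<subseteq> I\<rbrakk> \<Longrightarrow> alg_sums A X \<subseteq> I"
proof
  fix x assume "x \<in> alg_sums A X" "alg_left_ideal A I" "X \<subseteq> I"
  thus "x \<in> I" by induction (auto simp: alg_left_ideal_iff)
qed

lemma alg_ideal_imp_left_ideal: "alg_ideal A I \<Longrightarrow> alg_left_ideal A I"
  by (simp add: alg_ideal_def)

lemma alg_ideal_gen_least: "\<lbrakk>alg_ideal A I; X \<subseteq> I\<rbrakk> \<Longrightarrow> alg_ideal_gen A X \<subseteq> I"
  by (auto simp: alg_ideal_gen_def)

lemma alg_ideal_gen_superset: "X \<subseteq> alg_ideal_gen A X"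
  by (auto simp: alg_ideal_gen_def)

text \<open>The record has no subtraction; \<open>add_uminus\<close> makes multiplication by the
  scalar \<open>- 1\<close> the additive inverse.\<close>

locale nonunital_algebra =
  fixes A :: "('k::field, 'a) nu_algebra"
  assumes zero_closed [simp, intro]: "alg_zero A \<in> carrier A"
    and add_closed [simp, intro]:
      "\<lbrakk>x \<in> carrier A; y \<in> carrier A\<rbrakk> \<Longrightarrow> alg_add A x y \<in> carrier A"
    and mult_closed [simp, intro]:
      "\<lbrakk>x \<in> carrier A; y \<in> carrier A\<rbrakk> \<Longrightarrow> alg_mult A x y \<in> carrier A"
    and smult_closed [simp, intro]: "x \<in> carrier A \<Longrightarrow> alg_smult A c x \<in> carrier A"
    and add_assoc: "\<lbrakk>x \<in> carrier A; y \<in> carrier A; z \<in> carrier A\<rbrakk> \<Longrightarrow>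
      alg_add A (alg_add A x y) z = alg_add A x (alg_add A y z)"
    and add_commute: "\<lbrakk>x \<in> carrier A; y \<in> carrier A\<rbrakk> \<Longrightarrow> alg_add A x y = alg_add A y x"
    and add_zero [simp]: "x \<in> carrier A \<Longrightarrow> alg_add A x (alg_zero A) = x"
    and add_uminus: "x \<in> carrier A \<Longrightarrow> alg_add A x (alg_smult A (- 1) x) = alg_zero A"
    and mult_assoc: "\<lbrakk>x \<in> carrier A; y \<in> carrier A; z \<in> carrier A\<rbrakk> \<Longrightarrow>
      alg_mult A (alg_mult A x y) z = alg_mult A x (alg_mult A y z)"
    and distrib_left: "\<lbrakk>x \<in> carrier A; y \<in> carrier A; z \<in> carrier A\<rbrakk> \<Longrightarrow>
      alg_mult A x (alg_add A y z) = alg_add A (alg_mult A x y) (alg_mult A x z)"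
    and distrib_right: "\<lbrakk>x \<in> carrier A; y \<in> carrier A; z \<in> carrier A\<rbrakk> \<Longrightarrow>
      alg_mult A (alg_add A x y) z = alg_add A (alg_mult A x z) (alg_mult A y z)"
    and smult_add: "\<lbrakk>x \<in> carrier A; y \<in> carrier A\<rbrakk> \<Longrightarrow>
      alg_smult A c (alg_add A x y) = alg_add A (alg_smult A c x) (alg_smult A c y)"
    and smult_mult_left: "\<lbrakk>x \<in> carrier A; y \<in> carrier A\<rbrakk> \<Longrightarrow>
      alg_mult A (alg_smult A c x) y = alg_smult A c (alg_mult A x y)"
    and smult_mult_right: "\<lbrakk>x \<in> carrier A; y \<in> carrier A\<rbrakk> \<Longrightarrow>
      alg_mult A x (alg_smult A c y) = alg_smult A c (alg_mult A x y)"
begin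

lemma zero_add [simp]: "x \<in> carrier A \<Longrightarrow> alg_add A (alg_zero A) x = x"
  by (metis add_commute add_zero zero_closed)

lemma add_left_commute:
  "\<lbrakk>x \<in> carrier A; y \<in> carrier A; z \<in> carrier A\<rbrakk> \<Longrightarrow>
    alg_add A x (alg_add A y z) = alg_add A y (alg_add A x z)"
  by (metis add_assoc add_commute)

lemma add_left_imp_eq:
  assumes "alg_add A x y = alg_add A x z" "x \<in> carrier A" "y \<in> carrier A" "z \<in> carrier A"
  shows "y = z"
proof -
  let ?n = "alg_smult A (- 1) x"
  have "w = alg_add A ?n (alg_add A x w)" if "w \<in> carrier A" for w
    using that assms(2) add_assoc[of ?n x w] add_commute[of ?n x] add_uminus[of x] by simp
  thus ?thesis using assms by metis
qed

lemma add_eq_self: "\<lbrakk>alg_add A x y = x; x \<in> carrier A; y \<in> carrier A\<rbrakk> \<Longrightarrow> y = alg_zero A"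
  using add_left_imp_eq[of x y "alg_zero A"] by simp

lemma mult_zero [simp]: "x \<in> carrier A \<Longrightarrow> alg_mult A x (alg_zero A) = alg_zero A"
  using add_eq_self[of "alg_mult A x (alg_zero A)" "alg_mult A x (alg_zero A)"]
    distrib_left[of x "alg_zero A" "alg_zero A"] by simp

lemma zero_mult [simp]: "x \<in> carrier A \<Longrightarrow> alg_mult A (alg_zero A) x = alg_zero A"
  using add_eq_self[of "alg_mult A (alg_zero A) x" "alg_mult A (alg_zero A) x"]
    distrib_right[of "alg_zero A" "alg_zero A" x] by simp

lemma smult_zero [simp]: "alg_smult A c (alg_zero A) = alg_zero A"
  using add_eq_self[of "alg_smult A c (alg_zero A)" "alg_smult A c (alg_zero A)"]
    smult_add[of "alg_zero A" "alg_zero A" c] by simp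

lemma alg_ideal_zero: "alg_ideal A {alg_zero A}"
  by (simp add: alg_ideal_iff)

lemma alg_ideal_carrier: "alg_ideal A (carrier A)"
  by (simp add: alg_ideal_iff)

lemma alg_ideal_gen_ideal:
  assumes "X \<subseteq> carrier A" shows "alg_ideal A (alg_ideal_gen A X)"
proof -
  have "alg_ideal_gen A X \<subseteq> carrier A"
    by (rule alg_ideal_gen_least[OF alg_ideal_carrier assms])
  thus ?thesis unfolding alg_ideal_gen_def alg_ideal_iff by blast
qed

lemma diff_exists:
  assumes "x \<in> carrier A" "y \<in> carrier A"
  shows "\<exists>z\<in>carrier A. alg_add A y z = x"
proof
  let ?n = "alg_smult A (- 1) y"
  show "alg_add A x ?n \<in> carrier A" using assms by simp
  show "alg_add A y (alg_add A x ?n) = x"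
    using assms add_left_commute[of y x ?n] add_uminus[of y] by simp
qed

lemma alg_sums_carrier: "X \<subseteq> carrier A \<Longrightarrow> alg_sums A X \<subseteq> carrier A"
  by (rule alg_sums_subset_left_ideal[OF alg_ideal_imp_left_ideal[OF alg_ideal_carrier]])

lemma alg_sums_add:
  assumes "x \<in> alg_sums A X" "y \<in> alg_sums A X" "X \<subseteq> carrier A"
  shows "alg_add A x y \<in> alg_sums A X"
  using assms(1)
proof induction
  case zero
  thus ?case using assms(2) alg_sums_carrier[OF assms(3)] by auto
next
  case (add x' y')
  hence "alg_add A (alg_add A x' y') y = alg_add A x' (alg_add A y' y)"
    using assms alg_sums_carrier[OF assms(3)] by (intro add_assoc) auto
  thus ?case using add by (simp add: alg_sums.add)
qed

lemma alg_sums_superset: "X \<subseteq> carrier A \<Longrightarrow> X \<subseteq> alg_sums A X"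
  by (metis add_zero alg_sums.add alg_sums.zero subsetD subsetI)

section \<open>Multiples of minimal elements\<close>

lemma minimal_mod_carrier: "minimal_mod A I \<subseteq> carrier A"
  by (auto simp: minimal_mod_def)

text \<open>Scalars pass through products, so the same \<open>b\<close> recovers the multiple and
  the error term is scaled along. This turns the scalar-free \<open>alg_sums\<close> into a
  subspace.\<close>

lemma smult_minimal_mod:
  assumes I: "alg_ideal A I" and x: "x \<in> minimal_mod A I" and c: "alg_smult A c x \<notin> I"
  shows "alg_smult A c x \<in> minimal_mod A I"
  unfolding minimal_mod_def
proof (intro CollectI conjI ballI impI)
  have xc: "x \<in> carrier A" using x minimal_mod_carrier by auto
  thus "alg_smult A c x \<in> carrier A" by simp
  fix a assume a: "a \<in> carrier A" "alg_mult A a (alg_smult A c x) \<notin> I"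
  hence "alg_mult A a x \<notin> I"
    using I xc by (auto simp: smult_mult_right alg_ideal_iff)
  then obtain b i where b: "b \<in> carrier A" "i \<in> I"
    "alg_add A (alg_mult A b (alg_mult A a x)) i = x" using x a by (auto simp: minimal_mod_def)
  have "i \<in> carrier A" using b I by (auto simp: alg_ideal_iff)
  hence "alg_add A (alg_mult A b (alg_mult A a (alg_smult A c x))) (alg_smult A c i) = alg_smult A c x"
    using a b xc by (simp add: smult_mult_right smult_add[symmetric])
  thus "\<exists>b\<in>carrier A. \<exists>i\<in>I. alg_add A (alg_mult A b (alg_mult A a (alg_smult A c x))) i
      = alg_smult A c x"
    using b I by (intro bexI[of _ b] bexI[of _ "alg_smult A c i"]) (auto simp: alg_ideal_iff)
qed (rule c)

text \<open>The equation recovering \<open>x\<close> is multiplied by \<open>d\<close> on the right;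
  its error term stays in \<open>I\<close> because \<open>I\<close> is two-sided. This is the source
  of two-sidedness of the socle.\<close>

lemma mult_minimal_mod_right:
  assumes I: "alg_ideal A I" and x: "x \<in> minimal_mod A I" and d: "d \<in> carrier A"
    and "alg_mult A x d \<notin> I"
  shows "alg_mult A x d \<in> minimal_mod A I"
  unfolding minimal_mod_def
proof (intro CollectI conjI ballI impI)
  have xc: "x \<in> carrier A" using x minimal_mod_carrier by auto
  thus "alg_mult A x d \<in> carrier A" using d by simp
  fix a assume a: "a \<in> carrier A" "alg_mult A a (alg_mult A x d) \<notin> I"
  hence "alg_mult A a x \<notin> I"
    using I xc d by (auto simp: mult_assoc[symmetric] alg_ideal_iff)
  then obtain b i where b: "b \<in> carrier A" "i \<in> I"
    "alg_add A (alg_mult A b (alg_mult A a x)) i = x" using x a by (auto simp: minimal_mod_def)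
  have "i \<in> carrier A" using b I by (auto simp: alg_ideal_iff)
  hence "alg_add A (alg_mult A b (alg_mult A a (alg_mult A x d))) (alg_mult A i d) = alg_mult A x d"
    using a b xc d by (simp add: mult_assoc[symmetric] distrib_right[symmetric])
  thus "\<exists>b\<in>carrier A. \<exists>i\<in>I. alg_add A (alg_mult A b (alg_mult A a (alg_mult A x d))) i
      = alg_mult A x d"
    using b I d by (intro bexI[of _ b] bexI[of _ "alg_mult A i d"]) (auto simp: alg_ideal_iff)
qed (rule assms)

text \<open>Reassociation gives \<open>b\<close> recovering \<open>x\<close> from
  \<open>(a d) x\<close>; then \<open>d b\<close> recovers \<open>d x\<close>.\<close>

lemma mult_minimal_mod_left:
  assumes I: "alg_ideal A I" and x: "x \<in> minimal_mod A I" and d: "d \<in> carrier A"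
    and "alg_mult A d x \<notin> I"
  shows "alg_mult A d x \<in> minimal_mod A I"
  unfolding minimal_mod_def
proof (intro CollectI conjI ballI impI)
  have xc: "x \<in> carrier A" using x minimal_mod_carrier by auto
  thus "alg_mult A d x \<in> carrier A" using d by simp
  fix a assume a: "a \<in> carrier A" "alg_mult A a (alg_mult A d x) \<notin> I"
  hence "alg_mult A (alg_mult A a d) x \<notin> I"
    using xc d by (simp add: mult_assoc)
  then obtain b i where b: "b \<in> carrier A" "i \<in> I"
    "alg_add A (alg_mult A b (alg_mult A (alg_mult A a d) x)) i = x"
    using x a d by (auto simp: minimal_mod_def)
  have "i \<in> carrier A" using b I by (auto simp: alg_ideal_iff)
  hence "alg_mult A d x =
      alg_add A (alg_mult A d (alg_mult A b (alg_mult A (alg_mult A a d) x))) (alg_mult A d i)"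
    using a b xc d by (simp add: distrib_left[symmetric])
  hence "alg_add A (alg_mult A (alg_mult A d b) (alg_mult A a (alg_mult A d x))) (alg_mult A d i)
      = alg_mult A d x"
    using a b xc d by (simp add: mult_assoc)
  moreover have "alg_mult A d b \<in> carrier A" "alg_mult A d i \<in> I"
    using b d I by (auto simp: alg_ideal_iff)
  ultimately show "\<exists>b\<in>carrier A. \<exists>i\<in>I. alg_add A (alg_mult A b (alg_mult A a (alg_mult A d x))) i
      = alg_mult A d x"
    by blast
qed (rule assms)

lemma socle_step_superset:
  assumes "alg_ideal A I" shows "I \<union> minimal_mod A I \<subseteq> socle_step A I"
  unfolding socle_step_def
  by (rule alg_sums_superset) (use assms minimal_mod_carrier in \<open>auto simp: alg_ideal_iff\<close>)

text \<open>Each scalar, left or right multiple of a summand falls into \<open>I\<close> or is again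
  minimal modulo \<open>I\<close>, so closure follows summand by summand.\<close>

lemma alg_ideal_socle_step:
  assumes I: "alg_ideal A I" shows "alg_ideal A (socle_step A I)"
proof -
  let ?X = "I \<union> minimal_mod A I"
  have Xc: "?X \<subseteq> carrier A" using I minimal_mod_carrier by (auto simp: alg_ideal_iff)
  have Sc: "alg_sums A ?X \<subseteq> carrier A" by (rule alg_sums_carrier[OF Xc])
  have XS: "?X \<subseteq> alg_sums A ?X" by (rule alg_sums_superset[OF Xc])
  have "alg_smult A c x \<in> alg_sums A ?X" if "x \<in> alg_sums A ?X" for c x
    using that
  proof induction
    case (add x y)
    have "alg_smult A c x \<in> ?X" using add I smult_minimal_mod by (auto simp: alg_ideal_iff)
    thus ?case using add Xc Sc by (subst smult_add) (auto intro!: alg_sums.add)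
  qed (simp add: alg_sums.zero)
  moreover have "alg_mult A a x \<in> alg_sums A ?X" if "x \<in> alg_sums A ?X" "a \<in> carrier A" for a x
    using that
  proof induction
    case (add x y)
    have "alg_mult A a x \<in> ?X" using add I mult_minimal_mod_left by (auto simp: alg_ideal_iff)
    thus ?case using add Xc Sc by (subst distrib_left) (auto intro!: alg_sums.add)
  qed (simp add: alg_sums.zero)
  moreover have "alg_mult A x a \<in> alg_sums A ?X" if "x \<in> alg_sums A ?X" "a \<in> carrier A" for a x
    using that
  proof induction
    case (add x y)
    have "alg_mult A x a \<in> ?X" using add I mult_minimal_mod_right by (auto simp: alg_ideal_iff)
    thus ?case using add Xc Sc by (subst distrib_right) (auto intro!: alg_sums.add)
  qed (simp add: alg_sums.zero)
  ultimately show ?thesis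
    using Sc alg_sums_add[OF _ _ Xc] by (auto simp: socle_step_def alg_ideal_iff alg_sums.zero)
qed

section \<open>The socle in terms of minimal elements\<close>

lemma alg_left_ideal_principal:
  assumes x: "x \<in> carrier A"
  shows "alg_left_ideal A ((\<lambda>a. alg_mult A a x) ` carrier A)"
  unfolding alg_left_ideal_iff
proof (intro conjI ballI allI)
  show "alg_zero A \<in> (\<lambda>a. alg_mult A a x) ` carrier A"
    using x by (intro image_eqI[of _ _ "alg_zero A"]) auto
next
  fix y z assume "y \<in> (\<lambda>a. alg_mult A a x) ` carrier A" "z \<in> (\<lambda>a. alg_mult A a x) ` carrier A"
  thus "alg_add A y z \<in> (\<lambda>a. alg_mult A a x) ` carrier A"
    using x by (auto simp: distrib_right[symmetric])
next
  fix c y assume "y \<in> (\<lambda>a. alg_mult A a x) ` carrier A"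
  thus "alg_smult A c y \<in> (\<lambda>a. alg_mult A a x) ` carrier A"
    using x by (auto simp: smult_mult_left[symmetric])
next
  fix a y assume "a \<in> carrier A" "y \<in> (\<lambda>a. alg_mult A a x) ` carrier A"
  thus "alg_mult A a y \<in> (\<lambda>a. alg_mult A a x) ` carrier A"
    using x by (auto simp: mult_assoc[symmetric])
qed (use x in auto)

text \<open>A left unit puts \<open>x\<close> among its own left multiples. Hence a nonzero element
  of a minimal left ideal generates it, and conversely the left multiples of a minimal element form
  a minimal left ideal.\<close>

lemma socle_eq_socle_step:
  assumes units: "\<And>x. x \<in> carrier A \<Longrightarrow> \<exists>u\<in>carrier A. alg_mult A u x = x"
  shows "socle A = socle_step A {alg_zero A}"
proof
  let ?Z = "{alg_zero A}"
  have min_gen: "(\<lambda>a. alg_mult A a x) ` carrier A = M"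
    if M: "minimal_left_ideal A M" and x: "x \<in> M" "x \<noteq> alg_zero A" for M x
  proof -
    have xc: "x \<in> carrier A" using M x by (auto simp: minimal_left_ideal_def alg_left_ideal_iff)
    obtain u where "u \<in> carrier A" "alg_mult A u x = x" using units[OF xc] by auto
    hence "x \<in> (\<lambda>a. alg_mult A a x) ` carrier A" by force
    moreover have "(\<lambda>a. alg_mult A a x) ` carrier A \<subseteq> M"
      using M x by (auto simp: minimal_left_ideal_def alg_left_ideal_iff)
    ultimately show ?thesis
      using M x alg_left_ideal_principal[OF xc] unfolding minimal_left_ideal_def by blast
  qed
  have "M \<subseteq> ?Z \<union> minimal_mod A ?Z" if M: "minimal_left_ideal A M" for M
  proof
    fix x assume x: "x \<in> M"
    have Ml: "alg_left_ideal A M" using M by (simp add: minimal_left_ideal_def)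
    have "\<exists>b\<in>carrier A. \<exists>i\<in>?Z. alg_add A (alg_mult A b (alg_mult A a x)) i = x"
      if a: "a \<in> carrier A" "alg_mult A a x \<notin> ?Z" for a
    proof -
      have "alg_mult A a x \<in> M" using Ml x a by (simp add: alg_left_ideal_iff)
      hence "x \<in> (\<lambda>b. alg_mult A b (alg_mult A a x)) ` carrier A"
        using min_gen[OF M, of "alg_mult A a x"] a x by auto
      then obtain b where b: "b \<in> carrier A" "x = alg_mult A b (alg_mult A a x)" by blast
      moreover have "x \<in> carrier A" using x Ml by (auto simp: alg_left_ideal_iff)
      ultimately show ?thesis by (intro bexI[of _ b] bexI[of _ "alg_zero A"]) auto
    qed
    thus "x \<in> ?Z \<union> minimal_mod A ?Z" using x Ml by (auto simp: minimal_mod_def alg_left_ideal_iff)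
  qed
  hence "\<Union>{M. minimal_left_ideal A M} \<subseteq> socle_step A ?Z"
    using socle_step_superset[OF alg_ideal_zero] by blast
  thus "socle A \<subseteq> socle_step A ?Z"
    using alg_ideal_socle_step[OF alg_ideal_zero]
    by (auto simp: socle_def alg_left_ideal_gen_def alg_ideal_def)
  have "x \<in> \<Union>{M. minimal_left_ideal A M}" if x: "x \<in> minimal_mod A ?Z" for x
  proof -
    let ?M = "(\<lambda>a. alg_mult A a x) ` carrier A"
    have xc: "x \<in> carrier A" "x \<noteq> alg_zero A" using x by (auto simp: minimal_mod_def)
    obtain u where "u \<in> carrier A" "alg_mult A u x = x" using units[OF xc(1)] by auto
    hence xM: "x \<in> ?M" by force
    have "N = ?M" if N: "alg_left_ideal A N" "N \<subseteq> ?M" "N \<noteq> ?Z" for N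
    proof -
      \<comment> \<open>Some \<open>b\<close> carries the nonzero multiple \<open>y = a x\<close>
        back to \<open>x\<close>, so \<open>N\<close> contains \<open>x\<close> and all its
        multiples.\<close>
      obtain y where y: "y \<in> N" "y \<noteq> alg_zero A" using N by (auto simp: alg_left_ideal_iff)
      then obtain a where a: "a \<in> carrier A" "y = alg_mult A a x" using N by auto
      with y x obtain b where b: "b \<in> carrier A" "alg_mult A b (alg_mult A a x) = x"
        by (auto simp: minimal_mod_def)
      moreover have "alg_mult A b (alg_mult A a x) \<in> N"
        using N(1) y(1) a b(1) by (auto simp: alg_left_ideal_iff)
      ultimately have "x \<in> N" by simp
      hence "?M \<subseteq> N" using N by (auto simp: alg_left_ideal_iff)
      thus ?thesis using N by auto
    qed
    hence "minimal_left_ideal A ?M"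
      unfolding minimal_left_ideal_def using alg_left_ideal_principal[OF xc(1)] xM xc by auto
    thus ?thesis using xM by blast
  qed
  hence "minimal_mod A ?Z \<subseteq> \<Union>{M. minimal_left_ideal A M}" by (rule subsetI)
  hence "?Z \<union> minimal_mod A ?Z \<subseteq> I"
    if "alg_left_ideal A I" "\<Union>{M. minimal_left_ideal A M} \<subseteq> I" for I
    using that unfolding alg_left_ideal_iff by (simp add: subset_trans)
  hence "alg_sums A (?Z \<union> minimal_mod A ?Z) \<subseteq> I"
    if "alg_left_ideal A I" "\<Union>{M. minimal_left_ideal A M} \<subseteq> I" for I
    using that alg_sums_subset_left_ideal by metis
  thus "socle_step A ?Z \<subseteq> socle A"
    unfolding socle_step_def socle_def alg_left_ideal_gen_def by (intro Inter_greatest) simp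
qed

section \<open>Quotient algebras\<close>

lemma alg_coset_eq_iff:
  assumes I: "alg_ideal A I" and x: "x \<in> carrier A" and y: "y \<in> carrier A"
  shows "alg_coset A I x = alg_coset A I y \<longleftrightarrow> y \<in> alg_coset A I x"
proof
  have "y = alg_add A y (alg_zero A)" using y by simp
  thus "alg_coset A I x = alg_coset A I y \<Longrightarrow> y \<in> alg_coset A I x"
    using I by (auto simp: alg_coset_def alg_ideal_iff)
next
  assume "y \<in> alg_coset A I x"
  then obtain i where i: "i \<in> I" "y = alg_add A x i" by (auto simp: alg_coset_def)
  have Ic: "j \<in> carrier A" if "j \<in> I" for j using that I by (auto simp: alg_ideal_iff)
  let ?n = "alg_smult A (- 1) i"
  have n: "?n \<in> I" using i I by (auto simp: alg_ideal_iff)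
  have "x = alg_add A y ?n"
    using i x Ic n by (simp add: add_assoc add_uminus)
  hence "alg_add A x j = alg_add A y (alg_add A ?n j)" "alg_add A ?n j \<in> I" if "j \<in> I" for j
    using that Ic n i x y I add_assoc[of y ?n j] by (auto simp: alg_ideal_iff)
  moreover have "alg_add A y j = alg_add A x (alg_add A i j)" "alg_add A i j \<in> I" if "j \<in> I" for j
    using that Ic i x I by (auto simp: alg_ideal_iff add_assoc)
  ultimately show "alg_coset A I x = alg_coset A I y" unfolding alg_coset_def by blast
qed

lemma alg_coset_self:
  "\<lbrakk>alg_ideal A I; x \<in> carrier A\<rbrakk> \<Longrightarrow> x \<in> alg_coset A I x"
  using alg_coset_eq_iff by blast

lemma alg_coset_eq_zero_iff:
  assumes "alg_ideal A I" "x \<in> carrier A"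
  shows "alg_coset A I x = alg_coset A I (alg_zero A) \<longleftrightarrow> x \<in> I"
proof -
  have "I \<subseteq> carrier A" using assms by (auto simp: alg_ideal_iff)
  hence "alg_coset A I (alg_zero A) = I" unfolding alg_coset_def
    by (metis image_cong image_ident subsetD zero_add)
  thus ?thesis using alg_coset_eq_iff[OF assms(1), of "alg_zero A" x] assms by auto
qed

lemma alg_coset_carrier: "\<lbrakk>alg_ideal A I; x \<in> carrier A\<rbrakk> \<Longrightarrow> alg_coset A I x \<subseteq> carrier A"
  by (auto simp: alg_coset_def alg_ideal_iff)

lemma alg_quot_carrier: "carrier (alg_quot A I) = alg_coset A I ` carrier A"
  by (simp add: alg_quot_def)

lemma alg_quot_zero: "alg_zero (alg_quot A I) = alg_coset A I (alg_zero A)"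
  by (simp add: alg_quot_def)

text \<open>The union in \<open>alg_quot\<close> collapses: all representatives yield the same
  coset, and each coset has a representative by \<open>alg_coset_self\<close>.\<close>

lemma alg_quot_add:
  assumes I: "alg_ideal A I" and x: "x \<in> carrier A" and y: "y \<in> carrier A"
  shows "alg_add (alg_quot A I) (alg_coset A I x) (alg_coset A I y) = alg_coset A I (alg_add A x y)"
proof -
  have Ic: "j \<in> carrier A" if "j \<in> I" for j using that I by (auto simp: alg_ideal_iff)
  have "alg_coset A I (alg_add A x' y') = alg_coset A I (alg_add A x y)"
    if x': "x' \<in> alg_coset A I x" and y': "y' \<in> alg_coset A I y" for x' y'
  proof -
    obtain i j where "i \<in> I" "j \<in> I" "x' = alg_add A x i" "y' = alg_add A y j"
      using x' y' by (auto simp: alg_coset_def)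
    moreover from this have "alg_add A x' y' = alg_add A (alg_add A x y) (alg_add A i j)"
      using x y Ic by (simp add: add_assoc add_left_commute)
    ultimately have "alg_add A x' y' \<in> alg_coset A I (alg_add A x y)"
      using I by (auto simp: alg_coset_def alg_ideal_iff)
    thus ?thesis using alg_coset_eq_iff[OF I, of "alg_add A x y"] x y alg_coset_carrier[OF I]
      by blast
  qed
  hence "alg_add (alg_quot A I) (alg_coset A I x) (alg_coset A I y)
      = (\<Union>x'\<in>alg_coset A I x. \<Union>y'\<in>alg_coset A I y. alg_coset A I (alg_add A x y))"
    unfolding alg_quot_def by simp
  thus ?thesis using alg_coset_self[OF I x] alg_coset_self[OF I y] by blast
qed

lemma alg_quot_mult:
  assumes I: "alg_ideal A I" and x: "x \<in> carrier A" and y: "y \<in> carrier A"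
  shows "alg_mult (alg_quot A I) (alg_coset A I x) (alg_coset A I y) = alg_coset A I (alg_mult A x y)"
proof -
  have Ic: "j \<in> carrier A" if "j \<in> I" for j using that I by (auto simp: alg_ideal_iff)
  have "alg_coset A I (alg_mult A x' y') = alg_coset A I (alg_mult A x y)"
    if x': "x' \<in> alg_coset A I x" and y': "y' \<in> alg_coset A I y" for x' y'
  proof -
    obtain i j where ij: "i \<in> I" "j \<in> I" "x' = alg_add A x i" "y' = alg_add A y j"
      using x' y' by (auto simp: alg_coset_def)
    hence "alg_mult A x' y' = alg_add A (alg_mult A x y)
        (alg_add A (alg_mult A i y) (alg_add A (alg_mult A x j) (alg_mult A i j)))"
      using x y Ic by (simp add: distrib_left distrib_right add_assoc add_left_commute)
    moreover have "alg_add A (alg_mult A i y) (alg_add A (alg_mult A x j) (alg_mult A i j)) \<in> I"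
      using I ij x y Ic by (simp add: alg_ideal_iff)
    ultimately have "alg_mult A x' y' \<in> alg_coset A I (alg_mult A x y)"
      by (auto simp: alg_coset_def)
    thus ?thesis using alg_coset_eq_iff[OF I, of "alg_mult A x y"] x y alg_coset_carrier[OF I]
      by blast
  qed
  hence "alg_mult (alg_quot A I) (alg_coset A I x) (alg_coset A I y)
      = (\<Union>x'\<in>alg_coset A I x. \<Union>y'\<in>alg_coset A I y. alg_coset A I (alg_mult A x y))"
    unfolding alg_quot_def by simp
  thus ?thesis using alg_coset_self[OF I x] alg_coset_self[OF I y] by blast
qed

lemma alg_quot_smult:
  assumes I: "alg_ideal A I" and x: "x \<in> carrier A"
  shows "alg_smult (alg_quot A I) c (alg_coset A I x) = alg_coset A I (alg_smult A c x)"
proof -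
  have "alg_coset A I (alg_smult A c x') = alg_coset A I (alg_smult A c x)"
    if x': "x' \<in> alg_coset A I x" for x'
  proof -
    obtain i where "i \<in> I" "x' = alg_add A x i" using x' by (auto simp: alg_coset_def)
    hence "alg_smult A c x' \<in> alg_coset A I (alg_smult A c x)"
      using I x by (auto simp: alg_coset_def alg_ideal_iff smult_add)
    thus ?thesis using alg_coset_eq_iff[OF I, of "alg_smult A c x"] x alg_coset_carrier[OF I]
      by blast
  qed
  hence "alg_smult (alg_quot A I) c (alg_coset A I x)
      = (\<Union>x'\<in>alg_coset A I x. alg_coset A I (alg_smult A c x))"
    unfolding alg_quot_def by simp
  thus ?thesis using alg_coset_self[OF I x] by blast
qed

lemma nonunital_algebra_quot:
  assumes "alg_ideal A I" shows "nonunital_algebra (alg_quot A I)"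
  by unfold_locales
    (auto simp: alg_quot_carrier alg_quot_zero alg_quot_add[OF assms] alg_quot_mult[OF assms]
      alg_quot_smult[OF assms] add_assoc add_commute add_left_commute add_uminus mult_assoc distrib_left
      distrib_right smult_add smult_mult_left smult_mult_right)

lemma ring_epi_coset: "alg_ideal A I \<Longrightarrow> ring_epi A (alg_quot A I) (alg_coset A I)"
  by (simp add: ring_epi_def alg_quot_carrier alg_quot_add alg_quot_mult)

end

section \<open>Transport along surjective ring homomorphisms\<close>

lemma ring_epi_zero:
  assumes A: "nonunital_algebra A" and B: "nonunital_algebra B" and \<phi>: "ring_epi A B \<phi>"
  shows "\<phi> (alg_zero A) = alg_zero B"
proof -
  interpret A: nonunital_algebra A by fact
  interpret B: nonunital_algebra B by fact
  have "\<phi> (alg_zero A) \<in> carrier B" using \<phi> by (auto simp: ring_epi_def)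
  moreover have "\<phi> (alg_add A (alg_zero A) (alg_zero A)) = alg_add B (\<phi> (alg_zero A)) (\<phi> (alg_zero A))"
    using \<phi> A.zero_closed unfolding ring_epi_def by blast
  ultimately show ?thesis by (metis A.add_zero A.zero_closed B.add_eq_self)
qed

text \<open>Multipliers lift by surjectivity, and the error term lifts because the equation for it
  can be solved in \<open>A\<close>.\<close>

lemma minimal_mod_preimage:
  assumes A: "nonunital_algebra A" and B: "nonunital_algebra B" and \<phi>: "ring_epi A B \<phi>"
    and J: "J \<subseteq> carrier B" and x: "x \<in> carrier A"
  shows "x \<in> minimal_mod A {x \<in> carrier A. \<phi> x \<in> J} \<longleftrightarrow> \<phi> x \<in> minimal_mod B J"
proof -
  interpret A: nonunital_algebra A by fact
  interpret B: nonunital_algebra B by fact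
  let ?I = "{x \<in> carrier A. \<phi> x \<in> J}"
  have img: "\<phi> ` carrier A = carrier B"
    and add: "\<And>x y. \<lbrakk>x \<in> carrier A; y \<in> carrier A\<rbrakk> \<Longrightarrow> \<phi> (alg_add A x y) = alg_add B (\<phi> x) (\<phi> y)"
    and mult: "\<And>x y. \<lbrakk>x \<in> carrier A; y \<in> carrier A\<rbrakk> \<Longrightarrow> \<phi> (alg_mult A x y) = alg_mult B (\<phi> x) (\<phi> y)"
    using \<phi> by (auto simp: ring_epi_def)
  have \<phi>c: "\<phi> y \<in> carrier B" if "y \<in> carrier A" for y using that img by auto
  have ex: "(\<exists>b\<in>carrier A. \<exists>i\<in>?I. alg_add A (alg_mult A b (alg_mult A a x)) i = x) \<longleftrightarrow>
    (\<exists>b\<in>carrier B. \<exists>j\<in>J. alg_add B (alg_mult B b (alg_mult B (\<phi> a) (\<phi> x))) j = \<phi> x)" (is "?L \<longleftrightarrow> ?R")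
    if a: "a \<in> carrier A" for a
  proof
    assume ?L
    then obtain b i where b: "b \<in> carrier A" "i \<in> ?I" "alg_add A (alg_mult A b (alg_mult A a x)) i = x"
      by blast
    have "alg_add B (alg_mult B (\<phi> b) (alg_mult B (\<phi> a) (\<phi> x))) (\<phi> i) = \<phi> x"
      using arg_cong[OF b(3), of \<phi>] a b(1,2) x by (simp add: add mult)
    thus ?R using b \<phi>c by blast
  next
    assume ?R
    then obtain b j where b: "b \<in> carrier A" "j \<in> J"
      "alg_add B (alg_mult B (\<phi> b) (alg_mult B (\<phi> a) (\<phi> x))) j = \<phi> x"
      unfolding img[symmetric] by blast
    \<comment> \<open>\<open>i\<close> solves the equation in \<open>A\<close> exactly, whereas a
      preimage of \<open>j\<close> would do so only up to the kernel. Cancellation in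
      \<open>B\<close> then shows that it lies over \<open>j\<close>.\<close>
    obtain i where i: "i \<in> carrier A" "alg_add A (alg_mult A b (alg_mult A a x)) i = x"
      using A.diff_exists[OF x, of "alg_mult A b (alg_mult A a x)"] a b(1) x by auto
    have "alg_add B (alg_mult B (\<phi> b) (alg_mult B (\<phi> a) (\<phi> x))) (\<phi> i) = \<phi> x"
      using arg_cong[OF i(2), of \<phi>] a b(1) i(1) x by (simp add: add mult)
    hence "\<phi> i = j"
      using B.add_left_imp_eq[of "alg_mult B (\<phi> b) (alg_mult B (\<phi> a) (\<phi> x))" "\<phi> i" j] b J \<phi>c i(1) a x
      by auto
    thus ?L using b i by blast
  qed
  have mem: "alg_mult A a x \<in> ?I \<longleftrightarrow> alg_mult B (\<phi> a) (\<phi> x) \<in> J" if "a \<in> carrier A" for a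
    using that x by (simp add: mult)
  have "x \<in> minimal_mod A ?I \<longleftrightarrow> x \<notin> ?I \<and> (\<forall>a\<in>carrier A. alg_mult A a x \<notin> ?I \<longrightarrow>
      (\<exists>b\<in>carrier A. \<exists>i\<in>?I. alg_add A (alg_mult A b (alg_mult A a x)) i = x))"
    unfolding minimal_mod_def using x by (intro iffI) blast+
  also have "\<dots> \<longleftrightarrow> \<phi> x \<notin> J \<and> (\<forall>a\<in>carrier A. alg_mult B (\<phi> a) (\<phi> x) \<notin> J \<longrightarrow>
      (\<exists>b\<in>carrier B. \<exists>j\<in>J. alg_add B (alg_mult B b (alg_mult B (\<phi> a) (\<phi> x))) j = \<phi> x))"
    using x by (intro arg_cong2[of _ _ _ _ "(\<and>)"] ball_cong refl) (simp_all only: ex mem, simp)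
  also have "\<dots> \<longleftrightarrow> \<phi> x \<in> minimal_mod B J"
    unfolding minimal_mod_def img[symmetric] using x by blast
  finally show ?thesis .
qed

text \<open>A sum in \<open>B\<close> lifts summand by summand; a given element and such a lift
  differ by an element of the kernel, which lies in the preimage of \<open>J\<close>. Coset maps and
  isomorphisms are both treated by this lemma.\<close>

lemma socle_step_preimage:
  assumes A: "nonunital_algebra A" and B: "nonunital_algebra B" and \<phi>: "ring_epi A B \<phi>"
    and J: "alg_ideal B J"
  shows "socle_step A {x \<in> carrier A. \<phi> x \<in> J} = {x \<in> carrier A. \<phi> x \<in> socle_step B J}"
proof -
  interpret A: nonunital_algebra A by fact
  interpret B: nonunital_algebra B by fact
  let ?I = "{x \<in> carrier A. \<phi> x \<in> J}"
  let ?X = "?I \<union> minimal_mod A ?I" and ?Y = "J \<union> minimal_mod B J"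
  have img: "\<phi> ` carrier A = carrier B"
    and hom_add: "\<And>x y. \<lbrakk>x \<in> carrier A; y \<in> carrier A\<rbrakk> \<Longrightarrow> \<phi> (alg_add A x y) = alg_add B (\<phi> x) (\<phi> y)"
    using \<phi> by (auto simp: ring_epi_def)
  have Jc: "J \<subseteq> carrier B" and J0: "alg_zero B \<in> J" using J by (auto simp: alg_ideal_iff)
  have Xc: "?X \<subseteq> carrier A" using A.minimal_mod_carrier by auto
  have XY: "x \<in> ?X \<longleftrightarrow> \<phi> x \<in> ?Y" if "x \<in> carrier A" for x
    using minimal_mod_preimage[OF A B \<phi> Jc that] that by auto
  have "\<phi> x \<in> alg_sums B ?Y \<and> x \<in> carrier A" if "x \<in> alg_sums A ?X" for x
    using that
  proof induction
    case zero
    show ?case by (simp add: ring_epi_zero[OF A B \<phi>] alg_sums.zero)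
  next
    case (add x y)
    hence "x \<in> carrier A" using Xc by blast
    thus ?case using add XY[of x] by (auto simp: hom_add intro!: alg_sums.add)
  qed
  moreover have lift: "\<exists>x\<in>alg_sums A ?X. \<phi> x = y" if "y \<in> alg_sums B ?Y" for y
    using that
  proof induction
    case zero
    show ?case using ring_epi_zero[OF A B \<phi>] alg_sums.zero by blast
  next
    case (add y z)
    obtain x where x: "x \<in> alg_sums A ?X" "\<phi> x = z" using add by blast
    have "y \<in> carrier B" using add Jc B.minimal_mod_carrier by auto
    then obtain w where w: "w \<in> carrier A" "y = \<phi> w" using img by auto
    have "w \<in> ?X" using XY[OF w(1)] add w by simp
    hence "alg_add A w x \<in> alg_sums A ?X" using x by (intro alg_sums.add)
    moreover have "\<phi> (alg_add A w x) = alg_add B y z"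
      using w x A.alg_sums_carrier[OF Xc] by (auto simp: hom_add)
    ultimately show ?case by blast
  qed
  moreover have "x \<in> alg_sums A ?X" if x: "x \<in> carrier A" "\<phi> x \<in> alg_sums B ?Y" for x
  proof -
    obtain y where y: "y \<in> alg_sums A ?X" "\<phi> y = \<phi> x" using lift x by blast
    have yc: "y \<in> carrier A" using y A.alg_sums_carrier[OF Xc] by blast
    obtain z where z: "z \<in> carrier A" "alg_add A y z = x" using A.diff_exists x yc by blast
    have "alg_add B (\<phi> x) (\<phi> z) = \<phi> x" using hom_add[of y z] z yc y by simp
    hence "\<phi> z = alg_zero B" using B.add_eq_self[of "\<phi> x" "\<phi> z"] img x z by blast
    hence "z \<in> ?X" using z J0 by simp
    thus ?thesis using z A.alg_sums_add[OF y(1) _ Xc, of z] A.alg_sums_superset[OF Xc] by blast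
  qed
  ultimately show ?thesis unfolding socle_step_def by blast
qed

lemma alg_ideal_preimage:
  assumes A: "nonunital_algebra A" and B: "nonunital_algebra B" and \<phi>: "ring_epi A B \<phi>"
    and sm: "\<And>c x. x \<in> carrier A \<Longrightarrow> \<phi> (alg_smult A c x) = alg_smult B c (\<phi> x)"
    and J: "alg_ideal B J"
  shows "alg_ideal A {x \<in> carrier A. \<phi> x \<in> J}"
proof -
  interpret A: nonunital_algebra A by fact
  have "\<phi> x \<in> carrier B" if "x \<in> carrier A" for x using that \<phi> by (auto simp: ring_epi_def)
  thus ?thesis
    using \<phi> J ring_epi_zero[OF A B \<phi>] by (auto simp: alg_ideal_iff ring_epi_def sm)
qed

text \<open>That the image of \<open>I\<close> is an ideal is assumed because \<open>f\<close> need
  not be linear and could destroy closure under scalars. In the induction the image is known to be a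
  socle term of \<open>B\<close>.\<close>

lemma ring_iso_socle_step:
  assumes A: "nonunital_algebra A" and B: "nonunital_algebra B" and f: "f \<in> alg_ring_iso A B"
    and J: "alg_ideal B (f ` I)" and I: "I \<subseteq> carrier A"
  shows "f ` socle_step A I = socle_step B (f ` I)"
proof -
  have epi: "ring_epi A B f" and inj: "inj_on f (carrier A)"
    using f by (auto simp: alg_ring_iso_def ring_epi_def bij_betw_def)
  have "I = {x \<in> carrier A. f x \<in> f ` I}" using inj I by (auto dest: inj_onD)
  hence "socle_step A I = {x \<in> carrier A. f x \<in> socle_step B (f ` I)}"
    using socle_step_preimage[OF A B epi J] by simp
  moreover have "socle_step B (f ` I) \<subseteq> f ` carrier A"
    using nonunital_algebra.alg_ideal_socle_step[OF B J] epi by (auto simp: alg_ideal_iff ring_epi_def)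
  ultimately show ?thesis by auto
qed

text \<open>The three defining equations of \<open>socle_series\<close> become one recursion in
  terms of \<open>socle_step\<close>. The existence of left units passes to each quotient, where
  \<open>socle_eq_socle_step\<close> applies.\<close>

theorem socle_series_Suc:
  assumes A: "nonunital_algebra A"
    and units: "\<And>x. x \<in> carrier A \<Longrightarrow> \<exists>u\<in>carrier A. alg_mult A u x = x"
  shows "alg_ideal A (socle_series A n) \<and> socle_series A (Suc n) = socle_step A (socle_series A n)"
proof (induction n)
  case 0
  interpret nonunital_algebra A by fact
  show ?case using alg_ideal_zero socle_eq_socle_step[OF units] by simp
next
  case (Suc n)
  interpret nonunital_algebra A by fact
  let ?I = "socle_series A (Suc n)"
  have I: "alg_ideal A ?I" using Suc alg_ideal_socle_step by simp
  let ?Q = "alg_quot A ?I"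
  interpret Q: nonunital_algebra ?Q by (rule nonunital_algebra_quot[OF I])
  have "\<exists>u\<in>carrier ?Q. alg_mult ?Q u x = x" if "x \<in> carrier ?Q" for x
  proof -
    from that obtain y where y: "y \<in> carrier A" "x = alg_coset A ?I y" by (auto simp: alg_quot_carrier)
    with units obtain u where "u \<in> carrier A" "alg_mult A u y = y" by blast
    thus ?thesis using y I
      by (intro bexI[of _ "alg_coset A ?I u"]) (auto simp: alg_quot_carrier alg_quot_mult)
  qed
  hence "socle ?Q = socle_step ?Q {alg_zero ?Q}" by (rule Q.socle_eq_socle_step)
  \<comment> \<open>The zero ideal of the quotient pulls back to \<open>?I\<close>, so
    \<open>socle_step_preimage\<close> pulls the socle of the quotient back to
    \<open>socle_step A ?I\<close>.\<close>
  moreover have "{x \<in> carrier A. alg_coset A ?I x \<in> {alg_zero ?Q}} = ?I"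
    using I alg_coset_eq_zero_iff[OF I] by (auto simp: alg_quot_zero alg_ideal_iff)
  ultimately have "socle_step A ?I = socle_series A (Suc (Suc n))"
    using socle_step_preimage[OF _ _ ring_epi_coset[OF I] Q.alg_ideal_zero]
      nonunital_algebra_axioms Q.nonunital_algebra_axioms by (auto simp del: socle_series.simps(2) simp: socle_series.simps(3))
  thus ?case using I by simp
qed

section \<open>Grading of the free algebra\<close>

text \<open>A multiple of the empty word. It lies in the full monoid algebra but, unless zero,
  outside \<open>free_algebra\<close>, hence the separate closure rule
  \<open>free_algebra_scl\<close>.\<close>

abbreviation scl :: "'k \<Rightarrow> ('g gen_word \<Rightarrow>\<^sub>0 'k::field)" where
  "scl c \<equiv> Poly_Mapping.single 0 c"

lemma scl_commute: "x * scl c = scl c * (x :: 'g gen_word \<Rightarrow>\<^sub>0 'k::field)"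
proof (induction x rule: update_induct)
  case (update f a b)
  have "Poly_Mapping.update a b f = f + Poly_Mapping.single a b"
    using update(1) by (intro poly_mapping_eqI)
      (auto simp: lookup_update lookup_add lookup_single in_keys_iff when_def)
  thus ?case using update by (simp add: distrib_left distrib_right mult_single mult.commute)
qed simp

lemma mult_scl_left: "x * (scl c * y) = scl c * (x * (y :: 'g gen_word \<Rightarrow>\<^sub>0 'k::field))"
  by (metis mult.assoc scl_commute)

lemma scl_mult_scl: "scl c * (scl d * x) = scl (c * d) * (x :: 'g gen_word \<Rightarrow>\<^sub>0 'k::field)"
  by (simp add: mult.assoc[symmetric] mult_single)

lemma scl_minus_one: "scl (- 1) * x = - (x :: 'g gen_word \<Rightarrow>\<^sub>0 'k::field)"
  by (simp add: single_uminus)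

lemma poly_mapping_sum_single:
  "(p :: 'a \<Rightarrow>\<^sub>0 'b::comm_monoid_add) = (\<Sum>w\<in>Poly_Mapping.keys p. Poly_Mapping.single w (Poly_Mapping.lookup p w))"
  by (intro poly_mapping_eqI) (simp add: lookup_sum lookup_single when_def in_keys_iff)

abbreviation word_mon :: "'g list \<Rightarrow> ('g gen_word \<Rightarrow>\<^sub>0 'k::field)" where
  "word_mon l \<equiv> Poly_Mapping.single (Word l) 1"

lemma word_mon_Cons: "word_mon (g # l) = free_gen g * word_mon l"
  by (simp add: free_gen_def mult_single plus_gen_word_def)

lemma word_mon_Nil: "word_mon [] = (1 :: 'g gen_word \<Rightarrow>\<^sub>0 'k::field)"
  by (simp add: zero_gen_word_def[symmetric])

lemma single_word: "Poly_Mapping.single w c = scl c * word_mon (letters w)"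
  by (simp add: mult_single)

lemma free_algebra_carrier_iff:
  "p \<in> carrier (free_algebra X) \<longleftrightarrow>
     (\<forall>w\<in>Poly_Mapping.keys p. letters w \<noteq> [] \<and> set (letters w) \<subseteq> X)"
  by (simp add: free_algebra_def)

lemma free_algebra_simps [simp]:
  "alg_zero (free_algebra X) = 0" "alg_add (free_algebra X) = (+)"
  "alg_mult (free_algebra X) = (*)" "alg_smult (free_algebra X) = (\<lambda>c p. scl c * p)"
  by (simp_all add: free_algebra_def)

lemma letters_plus [simp]: "letters (u + w) = letters u @ letters w"
  by (simp add: plus_gen_word_def)

lemma letters_zero [simp]: "letters 0 = []"
  by (simp add: zero_gen_word_def)

lemma free_algebra_zero: "0 \<in> carrier (free_algebra X)"
  by (simp add: free_algebra_carrier_iff)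

lemma free_algebra_add:
  "\<lbrakk>x \<in> carrier (free_algebra X); y \<in> carrier (free_algebra X)\<rbrakk> \<Longrightarrow> x + y \<in> carrier (free_algebra X)"
  using keys_add[of x y] by (auto simp: free_algebra_carrier_iff)

lemma free_algebra_mult:
  "\<lbrakk>x \<in> carrier (free_algebra X); y \<in> carrier (free_algebra X)\<rbrakk> \<Longrightarrow> x * y \<in> carrier (free_algebra X)"
  using keys_mult[of x y] unfolding free_algebra_carrier_iff by fastforce

lemma free_algebra_scl:
  "x \<in> carrier (free_algebra X) \<Longrightarrow> scl c * x \<in> carrier (free_algebra X)"
  using keys_mult[of "scl c" x] unfolding free_algebra_carrier_iff by (fastforce split: if_splits)

lemma free_algebra_diff:
  "\<lbrakk>x \<in> carrier (free_algebra X); y \<in> carrier (free_algebra X)\<rbrakk> \<Longrightarrow> x - y \<in> carrier (free_algebra X)"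
  using free_algebra_add[OF _ free_algebra_scl, of x X y "- 1"] by (simp add: scl_minus_one)

lemma free_algebra_sum:
  "(\<And>i. i \<in> I \<Longrightarrow> f i \<in> carrier (free_algebra X)) \<Longrightarrow> sum f I \<in> carrier (free_algebra X)"
  by (induction I rule: infinite_finite_induct) (auto intro: free_algebra_add free_algebra_zero)

lemma nonunital_algebra_free_algebra: "nonunital_algebra (free_algebra X)"
  by unfold_locales
    (auto simp: free_algebra_zero free_algebra_add free_algebra_mult free_algebra_scl scl_minus_one
      algebra_simps mult_scl_left)

lemma free_algebra_word_mon:
  "\<lbrakk>l \<noteq> []; set l \<subseteq> X\<rbrakk> \<Longrightarrow> word_mon l \<in> carrier (free_algebra X)"
  by (simp add: free_algebra_carrier_iff)

lemma free_algebra_free_gen: "g \<in> X \<Longrightarrow> free_gen g \<in> carrier (free_algebra X)"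
  by (simp add: free_gen_def free_algebra_word_mon)

text \<open>The standard integer grading of a Leavitt path algebra, lifted to letters; all defining
  relations are homogeneous for it.\<close>

primrec letter_degree :: "('v, 'e) lpa_gen \<Rightarrow> int" where
  "letter_degree (Vertex v) = 0"
| "letter_degree (Edge e) = 1"
| "letter_degree (Ghost e) = - 1"

definition word_degree :: "('v, 'e) lpa_gen gen_word \<Rightarrow> int" where
  "word_degree w = sum_list (map letter_degree (letters w))"

lemma word_degree_plus [simp]: "word_degree (u + w) = word_degree u + word_degree w"
  by (simp add: word_degree_def)

lemma word_degree_zero [simp]: "word_degree 0 = 0"
  by (simp add: word_degree_def)

lift_definition hom_comp ::
    "int \<Rightarrow> (('v, 'e) lpa_gen gen_word \<Rightarrow>\<^sub>0 'k::zero) \<Rightarrow> ('v, 'e) lpa_gen gen_word \<Rightarrow>\<^sub>0 'k"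
  is "\<lambda>d p w. if word_degree w = d then p w else 0"
  by (rule finite_subset) auto

lemma hom_comp_zero [simp]: "hom_comp d 0 = 0"
  by transfer auto

lemma hom_comp_add: "hom_comp d (x + y) = hom_comp d x + hom_comp d (y :: _ \<Rightarrow>\<^sub>0 'k::field)"
  by transfer auto

lemma hom_comp_diff: "hom_comp d (x - y) = hom_comp d x - hom_comp d (y :: _ \<Rightarrow>\<^sub>0 'k::field)"
  by transfer auto

lemma hom_comp_sum: "hom_comp d (sum f I) = (\<Sum>i\<in>I. hom_comp d (f i :: _ \<Rightarrow>\<^sub>0 'k::field))"
  by (induction I rule: infinite_finite_induct) (auto simp: hom_comp_add)

lemma hom_comp_single:
  "hom_comp d (Poly_Mapping.single w c) = (if word_degree w = d then Poly_Mapping.single w c else 0)"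
  by transfer (auto simp: when_def)

lemma keys_hom_comp: "Poly_Mapping.keys (hom_comp d x) = {w \<in> Poly_Mapping.keys x. word_degree w = d}"
  by transfer auto

lemma hom_comp_mult_single:
  "hom_comp d (x * Poly_Mapping.single w c) =
     hom_comp (d - word_degree w) x * Poly_Mapping.single w (c :: 'k::field)"
proof -
  have "hom_comp d (Poly_Mapping.single u b * Poly_Mapping.single w c) =
      hom_comp (d - word_degree w) (Poly_Mapping.single u b) * Poly_Mapping.single w c" for u b
    by (auto simp: mult_single hom_comp_single)
  thus ?thesis
    by (subst (1 2) poly_mapping_sum_single[of x]) (simp add: sum_distrib_right hom_comp_sum)
qed

lemma hom_comp_single_mult:
  "hom_comp d (Poly_Mapping.single w c * x) =
     Poly_Mapping.single w (c :: 'k::field) * hom_comp (d - word_degree w) x"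
proof -
  have "hom_comp d (Poly_Mapping.single w c * Poly_Mapping.single u b) =
      Poly_Mapping.single w c * hom_comp (d - word_degree w) (Poly_Mapping.single u b)" for u b
    by (auto simp: mult_single hom_comp_single)
  thus ?thesis
    by (subst (1 2) poly_mapping_sum_single[of x]) (simp add: sum_distrib_left hom_comp_sum)
qed

lemma hom_comp_scl: "hom_comp d (scl c * x) = scl c * hom_comp d (x :: _ \<Rightarrow>\<^sub>0 'k::field)"
  by (simp add: hom_comp_single_mult)

lemma sum_hom_comp:
  assumes "finite D" "word_degree ` Poly_Mapping.keys x \<subseteq> D"
  shows "(\<Sum>d\<in>D. hom_comp d x) = (x :: _ \<Rightarrow>\<^sub>0 'k::field)"
  using assms
  by (intro poly_mapping_eqI)
    (auto simp: lookup_sum hom_comp.rep_eq in_keys_iff image_subset_iff)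

lemma free_algebra_hom_comp:
  "x \<in> carrier (free_algebra X) \<Longrightarrow> hom_comp d x \<in> carrier (free_algebra X)"
  by (auto simp: free_algebra_carrier_iff keys_hom_comp)

definition graded :: "(('v, 'e) lpa_gen gen_word \<Rightarrow>\<^sub>0 'k::field) set \<Rightarrow> bool" where
  "graded T \<longleftrightarrow> (\<forall>x\<in>T. \<forall>d. hom_comp d x \<in> T)"

lemma alg_ideal_free_algebra_iff:
  "alg_ideal (free_algebra X) T \<longleftrightarrow> T \<subseteq> carrier (free_algebra X) \<and> 0 \<in> T \<and>
     (\<forall>x\<in>T. \<forall>y\<in>T. x + y \<in> T) \<and> (\<forall>c. \<forall>x\<in>T. scl c * x \<in> T) \<and>
     (\<forall>a\<in>carrier (free_algebra X). \<forall>x\<in>T. a * x \<in> T) \<and>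
     (\<forall>a\<in>carrier (free_algebra X). \<forall>x\<in>T. x * a \<in> T)"
  by (simp add: alg_ideal_iff)

text \<open>The elements all of whose components lie in the generated ideal form an ideal
  themselves, and it contains the generators.\<close>

lemma graded_alg_ideal_gen:
  fixes Y :: "(('v, 'e) lpa_gen gen_word \<Rightarrow>\<^sub>0 'k::field) set"
  assumes Y: "Y \<subseteq> carrier (free_algebra X)"
    and hom: "\<And>y d. y \<in> Y \<Longrightarrow> hom_comp d y \<in> alg_ideal_gen (free_algebra X) Y"
  shows "graded (alg_ideal_gen (free_algebra X) Y)"
proof -
  let ?A = "free_algebra X :: ('k, ('v, 'e) lpa_gen gen_word \<Rightarrow>\<^sub>0 'k) nu_algebra"
  let ?I = "alg_ideal_gen ?A Y"
  let ?J = "{x \<in> carrier ?A. \<forall>d. hom_comp d x \<in> ?I}"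
  interpret nonunital_algebra ?A by (rule nonunital_algebra_free_algebra)
  have I: "alg_ideal ?A ?I" by (rule alg_ideal_gen_ideal[OF Y])
  note I' = I[unfolded alg_ideal_free_algebra_iff]
  have sumI: "sum f S \<in> ?I" if "\<And>i. i \<in> S \<Longrightarrow> f i \<in> ?I" for f and S :: "'b set"
    using that I' by (induction S rule: infinite_finite_induct) auto
  \<comment> \<open>The other factor is split into words, each of which merely shifts the
    degree.\<close>
  have split: "hom_comp d (a * x) = (\<Sum>w\<in>Poly_Mapping.keys a.
        Poly_Mapping.single w (Poly_Mapping.lookup a w) * hom_comp (d - word_degree w) x)"
      "hom_comp d (x * a) = (\<Sum>w\<in>Poly_Mapping.keys a.
        hom_comp (d - word_degree w) x * Poly_Mapping.single w (Poly_Mapping.lookup a w))"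
    for a x :: "('v, 'e) lpa_gen gen_word \<Rightarrow>\<^sub>0 'k" and d
    by (subst (1) poly_mapping_sum_single[of a],
        simp add: sum_distrib_left sum_distrib_right hom_comp_sum hom_comp_single_mult
          hom_comp_mult_single)+
  have mon: "Poly_Mapping.single w (Poly_Mapping.lookup a w) \<in> carrier ?A"
    if "a \<in> carrier ?A" "w \<in> Poly_Mapping.keys a" for a w
    using that by (auto simp: free_algebra_carrier_iff)
  have "alg_ideal ?A ?J"
    unfolding alg_ideal_free_algebra_iff
  proof (intro conjI ballI allI)
    fix x y assume "x \<in> ?J" "y \<in> ?J"
    thus "x + y \<in> ?J" using I' by (auto simp: hom_comp_add free_algebra_add)
  next
    fix c x assume "x \<in> ?J"
    thus "scl c * x \<in> ?J" using I' by (auto simp: hom_comp_scl free_algebra_scl)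
  next
    fix a x assume a: "a \<in> carrier ?A" and x: "x \<in> ?J"
    have "hom_comp d (a * x) \<in> ?I" "hom_comp d (x * a) \<in> ?I" for d
      unfolding split(1)[of d a x] split(2)[of d x a] using x I' mon[OF a] by (auto intro!: sumI)
    thus "a * x \<in> ?J" "x * a \<in> ?J" using a x by (auto simp: free_algebra_mult)
  qed (use I' in \<open>auto simp: free_algebra_zero\<close>)
  hence "?I \<subseteq> ?J" by (rule alg_ideal_gen_least) (use Y hom in auto)
  thus ?thesis by (auto simp: graded_def)
qed

section \<open>Walks in graded quotients of a Leavitt path algebra\<close>

text \<open>The end vertex belongs to the word: without a unit, the trivial walk still has to be a
  nonempty word.\<close>

primrec walk_mon :: "'e list \<Rightarrow> 'v \<Rightarrow> (('v, 'e) lpa_gen gen_word \<Rightarrow>\<^sub>0 'k::field)" where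
  "walk_mon [] w = free_gen (Vertex w)"
| "walk_mon (e # p) w = free_gen (Edge e) * walk_mon p w"

text \<open>The adjoint of \<open>walk_mon\<close>: the end vertex comes first and the ghost edges
  follow in reverse order.\<close>

primrec ghost_mon :: "'e list \<Rightarrow> 'v \<Rightarrow> (('v, 'e) lpa_gen gen_word \<Rightarrow>\<^sub>0 'k::field)" where
  "ghost_mon [] w = free_gen (Vertex w)"
| "ghost_mon (e # p) w = ghost_mon p w * free_gen (Ghost e)"

lemma walk_mon_conv: "walk_mon p w = word_mon (map Edge p @ [Vertex w])"
  by (induction p) (simp_all add: word_mon_Cons word_mon_Nil)

lemma hom_comp_mult_walk_mon:
  "hom_comp d (x * walk_mon p w) = hom_comp (d - length p) x * walk_mon p (w :: 'v)"
proof -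
  have "sum_list (map letter_degree (map Edge p @ [Vertex w])) = length p"
    by (induction p) auto
  thus ?thesis unfolding walk_mon_conv hom_comp_mult_single word_degree_def by simp
qed

lemma hom_comp_walk_mon:
  "hom_comp d (walk_mon p w) = (if d = length p then walk_mon p w else 0)"
proof -
  have "sum_list (map letter_degree (map Edge p @ [Vertex w])) = length p"
    by (induction p) auto
  thus ?thesis unfolding walk_mon_conv hom_comp_single word_degree_def by simp
qed

lemma hom_comp_walk_mon_mult:
  "hom_comp d (walk_mon p w * x) = walk_mon p w * hom_comp (d - length p) x"
proof -
  have "sum_list (map letter_degree (map Edge p @ [Vertex w])) = length p"
    by (induction p) auto
  thus ?thesis unfolding walk_mon_conv hom_comp_single_mult word_degree_def by simp
qed

text \<open>\<open>T\<close> stands for the preimage of a graded ideal of the Leavitt path algebra,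
  so calculating modulo \<open>T\<close> means calculating in the quotient by that ideal.\<close>

locale graded_lpa_quotient = row_finite_digraph E
  for E :: "('v, 'e) pre_digraph" +
  fixes T :: "(('v, 'e) lpa_gen gen_word \<Rightarrow>\<^sub>0 'k::field) set"
  assumes ideal: "alg_ideal (free_algebra (lpa_gens E)) T"
    and relators: "lpa_relators E \<subseteq> T"
    and graded: "graded T"
begin

abbreviation C :: "(('v, 'e) lpa_gen gen_word \<Rightarrow>\<^sub>0 'k) set" where
  "C \<equiv> carrier (free_algebra (lpa_gens E))"

abbreviation vert :: "'v \<Rightarrow> ('v, 'e) lpa_gen gen_word \<Rightarrow>\<^sub>0 'k" where
  "vert v \<equiv> free_gen (Vertex v)"

abbreviation edge :: "'e \<Rightarrow> ('v, 'e) lpa_gen gen_word \<Rightarrow>\<^sub>0 'k" where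
  "edge e \<equiv> free_gen (Edge e)"

abbreviation ghost :: "'e \<Rightarrow> ('v, 'e) lpa_gen gen_word \<Rightarrow>\<^sub>0 'k" where
  "ghost e \<equiv> free_gen (Ghost e)"

abbreviation wm :: "'e list \<Rightarrow> 'v \<Rightarrow> ('v, 'e) lpa_gen gen_word \<Rightarrow>\<^sub>0 'k" where
  "wm \<equiv> walk_mon"

abbreviation gm :: "'e list \<Rightarrow> 'v \<Rightarrow> ('v, 'e) lpa_gen gen_word \<Rightarrow>\<^sub>0 'k" where
  "gm \<equiv> ghost_mon"

text \<open>Membership in \<open>C\<close> is included so that a congruence may be multiplied
  without further side conditions on its two sides.\<close>

definition eqv ::
    "(('v, 'e) lpa_gen gen_word \<Rightarrow>\<^sub>0 'k) \<Rightarrow> (('v, 'e) lpa_gen gen_word \<Rightarrow>\<^sub>0 'k) \<Rightarrow> bool"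
    (infix "\<simeq>" 50) where
  "x \<simeq> y \<longleftrightarrow> x \<in> C \<and> y \<in> C \<and> x - y \<in> T"

lemma T_C: "x \<in> T \<Longrightarrow> x \<in> C"
  and T_zero [simp]: "0 \<in> T"
  and T_add: "\<lbrakk>x \<in> T; y \<in> T\<rbrakk> \<Longrightarrow> x + y \<in> T"
  and T_scl: "x \<in> T \<Longrightarrow> scl c * x \<in> T"
  and T_mult_left: "\<lbrakk>x \<in> T; a \<in> C\<rbrakk> \<Longrightarrow> a * x \<in> T"
  and T_mult_right: "\<lbrakk>x \<in> T; a \<in> C\<rbrakk> \<Longrightarrow> x * a \<in> T"
  using ideal by (auto simp: alg_ideal_free_algebra_iff)

lemma T_uminus: "x \<in> T \<Longrightarrow> - x \<in> T"
  using T_scl[of x "- 1"] by (simp add: scl_minus_one)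

lemma T_diff: "\<lbrakk>x \<in> T; y \<in> T\<rbrakk> \<Longrightarrow> x - y \<in> T"
  using T_add[OF _ T_uminus, of x y] by simp

lemma T_hom_comp: "x \<in> T \<Longrightarrow> hom_comp d x \<in> T"
  using graded by (simp add: graded_def)

lemma T_scl_iff: "c \<noteq> 0 \<Longrightarrow> scl c * x \<in> T \<longleftrightarrow> x \<in> T"
  using T_scl[of "scl c * x" "inverse c"] T_scl[of x c] by (auto simp: scl_mult_scl)

lemma T_sum: "(\<And>i. i \<in> I \<Longrightarrow> f i \<in> T) \<Longrightarrow> sum f I \<in> T"
  by (induction I rule: infinite_finite_induct) (auto intro: T_add)

lemma vert_C [simp]: "v \<in> verts E \<Longrightarrow> vert v \<in> C"
  and edge_C [simp]: "e \<in> arcs E \<Longrightarrow> edge e \<in> C"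
  and ghost_C [simp]: "e \<in> arcs E \<Longrightarrow> ghost e \<in> C"
  by (auto intro!: free_algebra_free_gen simp: lpa_gens_def)

lemmas C_intros [simp, intro] = free_algebra_mult free_algebra_add free_algebra_scl free_algebra_diff
  free_algebra_hom_comp

lemma wm_C [simp]: "\<lbrakk>set p \<subseteq> arcs E; w \<in> verts E\<rbrakk> \<Longrightarrow> wm p w \<in> C"
  by (induction p) auto

lemma gm_C [simp]: "\<lbrakk>set p \<subseteq> arcs E; w \<in> verts E\<rbrakk> \<Longrightarrow> gm p w \<in> C"
  by (induction p) auto

lemma awalk_wm_C: "awalk u p w \<Longrightarrow> wm p w \<in> C"
  and awalk_gm_C: "awalk u p w \<Longrightarrow> gm p w \<in> C"
  using awalk_last_in_verts by (auto simp: awalk_def)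

lemma eqv_refl [simp]: "x \<in> C \<Longrightarrow> x \<simeq> x"
  by (simp add: eqv_def)

lemma eqv_sym: "x \<simeq> y \<Longrightarrow> y \<simeq> x"
  using T_uminus[of "x - y"] by (auto simp: eqv_def)

lemma eqv_trans [trans]: "\<lbrakk>x \<simeq> y; y \<simeq> z\<rbrakk> \<Longrightarrow> x \<simeq> z"
  using T_add[of "x - y" "y - z"] by (auto simp: eqv_def)

lemma eqv_add: "\<lbrakk>x \<simeq> x'; y \<simeq> y'\<rbrakk> \<Longrightarrow> x + y \<simeq> x' + y'"
  using T_add[of "x - x'" "y - y'"] by (auto simp: eqv_def algebra_simps)

lemma eqv_diff: "\<lbrakk>x \<simeq> x'; y \<simeq> y'\<rbrakk> \<Longrightarrow> x - y \<simeq> x' - y'"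
  using T_diff[of "x - x'" "y - y'"] by (auto simp: eqv_def algebra_simps)

lemma eqv_scl: "x \<simeq> y \<Longrightarrow> scl c * x \<simeq> scl c * y"
  using T_scl[of "x - y" c] by (auto simp: eqv_def right_diff_distrib)

lemma eqv_mult:
  assumes "x \<simeq> x'" "y \<simeq> y'" shows "x * y \<simeq> x' * y'"
proof -
  have "(x - x') * y + x' * (y - y') \<in> T"
    using assms by (intro T_add T_mult_right[of "x - x'"] T_mult_left[of "y - y'"]) (auto simp: eqv_def)
  thus ?thesis using assms by (auto simp: eqv_def algebra_simps)
qed

lemma eqv_mult_left: "\<lbrakk>x \<simeq> x'; y \<in> C\<rbrakk> \<Longrightarrow> y * x \<simeq> y * x'"
  by (simp add: eqv_mult)

lemma eqv_mult_right: "\<lbrakk>x \<simeq> x'; y \<in> C\<rbrakk> \<Longrightarrow> x * y \<simeq> x' * y"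
  by (simp add: eqv_mult)

lemma eqv_T: "x \<simeq> y \<Longrightarrow> x \<in> T \<longleftrightarrow> y \<in> T"
  using T_diff[of x "x - y"] T_add[of "x - y" y] by (auto simp: eqv_def)

lemma eqv_sum: "(\<And>i. i \<in> I \<Longrightarrow> f i \<simeq> g i) \<Longrightarrow> sum f I \<simeq> sum g I"
  by (induction I rule: infinite_finite_induct) (auto intro: eqv_add simp: free_algebra_zero)

lemma eqv_hom_comp: "x \<simeq> y \<Longrightarrow> hom_comp d x \<simeq> hom_comp d y"
  using T_hom_comp[of "x - y" d] by (auto simp: eqv_def hom_comp_diff)

lemma T_eqv_zero: "x \<in> T \<Longrightarrow> x \<simeq> 0"
  by (simp add: eqv_def T_C free_algebra_zero)

lemma eqv_relator: "\<lbrakk>x - y \<in> lpa_relators E; x \<in> C; y \<in> C\<rbrakk> \<Longrightarrow> x \<simeq> y"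
  using relators by (auto simp: eqv_def)

section \<open>The defining relations and local units modulo \<open>T\<close>\<close>

lemma vert_vert: "v \<in> verts E \<Longrightarrow> vert v * vert v \<simeq> vert v"
  using lpa_relators.vertices[of v E v] by (intro eqv_relator) auto

lemma vert_vert_T: "\<lbrakk>v \<in> verts E; w \<in> verts E; v \<noteq> w\<rbrakk> \<Longrightarrow> vert v * vert w \<in> T"
  using lpa_relators.vertices[of v E w, where 'k = 'k] relators by auto

lemma tail_edge: "e \<in> arcs E \<Longrightarrow> vert (tail E e) * edge e \<simeq> edge e"
  by (intro eqv_relator lpa_relators.source_edge) auto

lemma edge_head: "e \<in> arcs E \<Longrightarrow> edge e * vert (head E e) \<simeq> edge e"
  by (intro eqv_relator lpa_relators.edge_range) auto

lemma head_ghost: "e \<in> arcs E \<Longrightarrow> vert (head E e) * ghost e \<simeq> ghost e"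
  by (intro eqv_relator lpa_relators.range_ghost) auto

lemma ghost_tail: "e \<in> arcs E \<Longrightarrow> ghost e * vert (tail E e) \<simeq> ghost e"
  by (intro eqv_relator lpa_relators.ghost_source) auto

lemma ghost_edge: "e \<in> arcs E \<Longrightarrow> ghost e * edge e \<simeq> vert (head E e)"
  using lpa_relators.CK1[of e E e] by (intro eqv_relator) auto

lemma ghost_edge_T: "\<lbrakk>e \<in> arcs E; f \<in> arcs E; e \<noteq> f\<rbrakk> \<Longrightarrow> ghost e * edge f \<in> T"
  using lpa_relators.CK1[of e E f, where 'k = 'k] relators by auto

lemma out_arcs_arcs: "e \<in> out_arcs E v \<Longrightarrow> e \<in> arcs E \<and> tail E e = v"
  by auto

text \<open>Row-finiteness makes every vertex that emits an edge regular, so \<open>CK2\<close> is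
  available at each vertex that is not a sink.\<close>

lemma sum_edge_ghost:
  assumes "v \<in> verts E" "out_arcs E v \<noteq> {}"
  shows "vert v \<simeq> (\<Sum>e\<in>out_arcs E v. edge e * ghost e)"
  using assms finite_out_arcs
  by (intro eqv_relator lpa_relators.CK2 free_algebra_sum) (auto simp: regular_vertex_def)

text \<open>Endpoints in the double graph, where a ghost edge runs backwards.\<close>

primrec lsource :: "('v, 'e) lpa_gen \<Rightarrow> 'v" where
  "lsource (Vertex v) = v"
| "lsource (Edge e) = tail E e"
| "lsource (Ghost e) = head E e"

primrec lrange :: "('v, 'e) lpa_gen \<Rightarrow> 'v" where
  "lrange (Vertex v) = v"
| "lrange (Edge e) = head E e"
| "lrange (Ghost e) = tail E e"

lemma gens_cases:
  assumes "g \<in> lpa_gens E"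
  obtains v where "g = Vertex v" "v \<in> verts E" | e where "g = Edge e" "e \<in> arcs E"
    | e where "g = Ghost e" "e \<in> arcs E"
  using assms by (auto simp: lpa_gens_def)

lemma gen_C [simp]: "g \<in> lpa_gens E \<Longrightarrow> free_gen g \<in> C"
  by (rule free_algebra_free_gen)

lemma lsource_verts: "g \<in> lpa_gens E \<Longrightarrow> lsource g \<in> verts E"
  and lrange_verts: "g \<in> lpa_gens E \<Longrightarrow> lrange g \<in> verts E"
  by (auto elim!: gens_cases)

lemma lsource_gen: "g \<in> lpa_gens E \<Longrightarrow> vert (lsource g) * free_gen g \<simeq> free_gen g"
  by (auto elim!: gens_cases simp: vert_vert tail_edge head_ghost)

lemma gen_lrange: "g \<in> lpa_gens E \<Longrightarrow> free_gen g * vert (lrange g) \<simeq> free_gen g"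
  by (auto elim!: gens_cases simp: vert_vert edge_head ghost_tail)

text \<open>The generator absorbs its own source vertex, and distinct vertices are
  orthogonal.\<close>

lemma vert_gen_T:
  assumes "g \<in> lpa_gens E" "v \<in> verts E" "v \<noteq> lsource g"
  shows "vert v * free_gen g \<in> T"
proof -
  have "(vert v * vert (lsource g)) * free_gen g \<simeq> vert v * free_gen g"
    using eqv_mult_left[OF lsource_gen[OF assms(1)], of "vert v"] assms by (simp add: mult.assoc)
  moreover have "(vert v * vert (lsource g)) * free_gen g \<in> T"
    using assms lsource_verts by (intro T_mult_right vert_vert_T) auto
  ultimately show ?thesis using eqv_T by blast
qed

lemma gen_vert_T:
  assumes "g \<in> lpa_gens E" "v \<in> verts E" "v \<noteq> lrange g"
  shows "free_gen g * vert v \<in> T"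
proof -
  have "free_gen g * (vert (lrange g) * vert v) \<simeq> free_gen g * vert v"
    using eqv_mult_right[OF gen_lrange[OF assms(1)], of "vert v"] assms by (simp add: mult.assoc)
  moreover have "free_gen g * (vert (lrange g) * vert v) \<in> T"
    using assms lrange_verts by (intro T_mult_left vert_vert_T) auto
  ultimately show ?thesis using eqv_T by blast
qed

lemma word_mon_C: "\<lbrakk>l \<noteq> []; set l \<subseteq> lpa_gens E\<rbrakk> \<Longrightarrow> word_mon l \<in> C"
  by (rule free_algebra_word_mon)

lemma word_mon_snoc: "word_mon (l @ [g]) = (word_mon l * free_gen g :: _ \<Rightarrow>\<^sub>0 'k)"
  by (simp add: free_gen_def mult_single plus_gen_word_def)

lemma vert_word_mon_cases:
  assumes "l \<noteq> []" "set l \<subseteq> lpa_gens E" "v \<in> verts E"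
  shows "if v = lsource (hd l) then vert v * word_mon l \<simeq> word_mon l else vert v * word_mon l \<in> T"
    and "if v = lrange (last l) then word_mon l * vert v \<simeq> word_mon l else word_mon l * vert v \<in> T"
proof -
  obtain g l' where l: "l = g # l'" using assms by (cases l) auto
  have g: "g \<in> lpa_gens E" using assms l by auto
  show "if v = lsource (hd l) then vert v * word_mon l \<simeq> word_mon l else vert v * word_mon l \<in> T"
  proof (cases "l' = []")
    case True
    thus ?thesis using lsource_gen[OF g] vert_gen_T[OF g assms(3)] l by (simp add: free_gen_def)
  next
    case False
    hence "word_mon l' \<in> C" using assms l by (intro word_mon_C) auto
    thus ?thesis using eqv_mult_right[OF lsource_gen[OF g]] T_mult_right[OF vert_gen_T[OF g assms(3)]] l
      by (simp add: word_mon_Cons mult.assoc)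
  qed
  obtain h m where m: "l = m @ [h]" using assms by (cases l rule: rev_cases) auto
  have h: "h \<in> lpa_gens E" using assms m by auto
  show "if v = lrange (last l) then word_mon l * vert v \<simeq> word_mon l else word_mon l * vert v \<in> T"
  proof (cases "m = []")
    case True
    thus ?thesis using gen_lrange[OF h] gen_vert_T[OF h assms(3)] m by (simp add: free_gen_def)
  next
    case False
    hence "word_mon m \<in> C" using assms m by (intro word_mon_C) auto
    thus ?thesis using eqv_mult_left[OF gen_lrange[OF h]] T_mult_left[OF gen_vert_T[OF h assms(3)]] m
      by (simp add: word_mon_snoc mult.assoc)
  qed
qed

lemma C_keys:
  assumes "x \<in> C" "w \<in> Poly_Mapping.keys x"
  shows "letters w \<noteq> []" "set (letters w) \<subseteq> lpa_gens E"
  using assms by (auto simp: free_algebra_carrier_iff)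

lemma C_sum_words:
  "x = (\<Sum>w\<in>Poly_Mapping.keys x. scl (Poly_Mapping.lookup x w) * word_mon (letters w))"
  unfolding single_word[symmetric] by (rule poly_mapping_sum_single)

text \<open>The sum of the source vertices of the words of \<open>x\<close> is a unit on the left:
  by orthogonality exactly one summand acts on a given word, and it acts as the identity.\<close>

lemma left_unit:
  assumes x: "x \<in> C" shows "\<exists>u\<in>C. u * x \<simeq> x"
proof -
  \<comment> \<open>A set, so a source shared by several words is counted once.\<close>
  let ?V = "(\<lambda>w. lsource (hd (letters w))) ` Poly_Mapping.keys x"
  have V: "v \<in> verts E" if "v \<in> ?V" for v
    using that C_keys[OF x] hd_in_set lsource_verts by blast
  let ?u = "\<Sum>v\<in>?V. vert v"
  have unit: "?u * word_mon (letters w) \<simeq> word_mon (letters w)" if w: "w \<in> Poly_Mapping.keys x" for w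
  proof -
    let ?l = "letters w" and ?s = "lsource (hd (letters w))"
    have "?u * word_mon ?l = (\<Sum>v\<in>?V. vert v * word_mon ?l)" by (rule sum_distrib_right)
    also have "\<dots> \<simeq> (\<Sum>v\<in>?V. if v = ?s then word_mon ?l else 0)"
    proof (rule eqv_sum)
      fix v assume "v \<in> ?V"
      thus "vert v * word_mon ?l \<simeq> (if v = ?s then word_mon ?l else 0)"
        using vert_word_mon_cases(1)[OF C_keys[OF x w] V, of v] T_eqv_zero by auto
    qed
    also have "(\<Sum>v\<in>?V. if v = ?s then word_mon ?l else 0) = word_mon ?l"
      using w by (subst sum.delta) auto
    finally show ?thesis .
  qed
  have "?u * x = (\<Sum>w\<in>Poly_Mapping.keys x. scl (Poly_Mapping.lookup x w) * (?u * word_mon (letters w)))"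
    by (subst C_sum_words[of x]) (simp only: sum_distrib_left mult_scl_left)
  also have "\<dots> \<simeq> (\<Sum>w\<in>Poly_Mapping.keys x. scl (Poly_Mapping.lookup x w) * word_mon (letters w))"
    by (intro eqv_sum eqv_scl unit)
  also have "\<dots> = x" by (rule C_sum_words[symmetric])
  finally show ?thesis using V by (intro bexI[of _ ?u]) (auto intro!: free_algebra_sum)
qed

text \<open>Dually to \<open>left_unit\<close>, the sum of the range vertices fixes \<open>x\<close>
  on the right; were all products with single vertices zero, \<open>x\<close> would be zero.\<close>

lemma right_vert:
  assumes x: "x \<in> C" "x \<notin> T" shows "\<exists>v\<in>verts E. x * vert v \<notin> T"
proof (rule ccontr)
  assume "\<not> ?thesis"
  hence zero: "x * vert v \<in> T" if "v \<in> verts E" for v using that by blast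
  let ?V = "(\<lambda>w. lrange (last (letters w))) ` Poly_Mapping.keys x"
  have V: "v \<in> verts E" if "v \<in> ?V" for v
    using that C_keys[OF x(1)] last_in_set lrange_verts by blast
  let ?u = "\<Sum>v\<in>?V. vert v"
  have unit: "word_mon (letters w) * ?u \<simeq> word_mon (letters w)" if w: "w \<in> Poly_Mapping.keys x" for w
  proof -
    let ?l = "letters w" and ?s = "lrange (last (letters w))"
    have "word_mon ?l * ?u = (\<Sum>v\<in>?V. word_mon ?l * vert v)" by (rule sum_distrib_left)
    also have "\<dots> \<simeq> (\<Sum>v\<in>?V. if v = ?s then word_mon ?l else 0)"
    proof (rule eqv_sum)
      fix v assume "v \<in> ?V"
      thus "word_mon ?l * vert v \<simeq> (if v = ?s then word_mon ?l else 0)"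
        using vert_word_mon_cases(2)[OF C_keys[OF x(1) w] V, of v] T_eqv_zero by auto
    qed
    also have "(\<Sum>v\<in>?V. if v = ?s then word_mon ?l else 0) = word_mon ?l"
      using w by (subst sum.delta) auto
    finally show ?thesis .
  qed
  have "x * ?u = (\<Sum>w\<in>Poly_Mapping.keys x. scl (Poly_Mapping.lookup x w) * (word_mon (letters w) * ?u))"
    by (subst C_sum_words[of x]) (simp only: sum_distrib_right mult.assoc)
  also have "\<dots> \<simeq> (\<Sum>w\<in>Poly_Mapping.keys x. scl (Poly_Mapping.lookup x w) * word_mon (letters w))"
    by (intro eqv_sum eqv_scl unit)
  also have "\<dots> = x" by (rule C_sum_words[symmetric])
  finally have "x * ?u \<simeq> x" .
  moreover have "x * ?u \<in> T"
    unfolding sum_distrib_left using V by (auto intro!: T_sum zero)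
  ultimately show False using x eqv_T by blast
qed

section \<open>Products of walks and ghost walks\<close>

lemma vert_walk:
  assumes "awalk u p w" shows "vert u * wm p w \<simeq> wm p w"
proof (cases p)
  case Nil
  thus ?thesis using assms by (auto simp: awalk_Nil_iff vert_vert)
next
  case (Cons e q)
  hence e: "e \<in> arcs E" "u = tail E e" "awalk (head E e) q w" using assms by (auto simp: awalk_Cons_iff)
  thus ?thesis using eqv_mult_right[OF tail_edge[OF e(1)] awalk_wm_C[OF e(3)]] Cons
    by (simp add: mult.assoc)
qed

lemma vert_walk_T:
  assumes "awalk u p w" "u' \<in> verts E" "u' \<noteq> u" shows "vert u' * wm p w \<in> T"
proof -
  have u: "u \<in> verts E" using assms by auto
  have "(vert u' * vert u) * wm p w \<simeq> vert u' * wm p w"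
    using eqv_mult_left[OF vert_walk[OF assms(1)], of "vert u'"] assms by (simp add: mult.assoc)
  moreover have "(vert u' * vert u) * wm p w \<in> T"
    using assms u awalk_wm_C[OF assms(1)] by (intro T_mult_right vert_vert_T) auto
  ultimately show ?thesis using eqv_T by blast
qed

lemma walk_vert: "\<lbrakk>set p \<subseteq> arcs E; w \<in> verts E\<rbrakk> \<Longrightarrow> wm p w * vert w \<simeq> wm p w"
  by (induction p) (auto simp: vert_vert mult.assoc intro: eqv_mult_left)

lemma edge_walk_T:
  assumes "e \<in> arcs E" "awalk u p w" "head E e \<noteq> u"
  shows "edge e * wm p w \<in> T"
proof -
  have "edge e * (vert (head E e) * wm p w) \<simeq> edge e * wm p w"
    using eqv_mult_right[OF edge_head[OF assms(1)] awalk_wm_C[OF assms(2)]] by (simp add: mult.assoc)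
  moreover have "edge e * (vert (head E e) * wm p w) \<in> T"
    using assms by (intro T_mult_left vert_walk_T) auto
  ultimately show ?thesis using eqv_T by blast
qed

lemma ghost_walk:
  assumes "awalk u (e # p) w" shows "ghost e * wm (e # p) w \<simeq> wm p w"
proof -
  have e: "e \<in> arcs E" "awalk (head E e) p w" using assms by (auto simp: awalk_Cons_iff)
  have "ghost e * wm (e # p) w = (ghost e * edge e) * wm p w" by (simp add: mult.assoc)
  also have "\<dots> \<simeq> vert (head E e) * wm p w"
    by (rule eqv_mult_right[OF ghost_edge[OF e(1)] awalk_wm_C[OF e(2)]])
  also have "\<dots> \<simeq> wm p w" by (rule vert_walk[OF e(2)])
  finally show ?thesis .
qed

lemma ghost_walk_T:
  assumes "awalk u (e # p) w" "f \<in> arcs E" "f \<noteq> e" shows "ghost f * wm (e # p) w \<in> T"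
proof -
  have e: "e \<in> arcs E" "awalk (head E e) p w" using assms by (auto simp: awalk_Cons_iff)
  have "(ghost f * edge e) * wm p w \<in> T"
    using e assms awalk_wm_C[OF e(2)] by (intro T_mult_right ghost_edge_T) auto
  thus ?thesis by (simp add: mult.assoc)
qed

lemma walk_append:
  assumes "set p \<subseteq> arcs E" "awalk v q w" shows "wm p v * wm q w \<simeq> wm (p @ q) w"
  using assms(1)
proof (induction p)
  case Nil
  show ?case using vert_walk[OF assms(2)] by simp
next
  case (Cons e p)
  thus ?case by (auto simp: mult.assoc intro: eqv_mult_left)
qed

text \<open>By \<open>CK1\<close> the ghost edges cancel edges of \<open>p\<close> from the front,
  and the first mismatch gives zero. The length bound keeps \<open>p\<close> from being used up
  before the ghost edges are.\<close>

lemma ghost_mon_walk: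
  assumes "awalk u q v" "awalk u' p w" "length q \<le> length p"
  shows "gm q v * wm p w \<in> T \<or> (\<exists>r. p = q @ r \<and> awalk v r w \<and> gm q v * wm p w \<simeq> wm r w)"
  using assms
proof (induction q arbitrary: u u' p)
  case Nil
  hence u: "u = v" "v \<in> verts E" by (auto simp: awalk_Nil_iff)
  show ?case
  proof (cases "v = u'")
    case True
    thus ?thesis using Nil vert_walk[of u' p w] by auto
  next
    case False
    thus ?thesis using vert_walk_T[OF Nil(2) u(2)] by simp
  qed
next
  case (Cons e q)
  obtain f p' where p: "p = f # p'" using Cons.prems by (cases p) auto
  have e: "e \<in> arcs E" "awalk (head E e) q v" and f: "f \<in> arcs E" "awalk (head E f) p' w"
    using Cons.prems p by (auto simp: awalk_Cons_iff)
  have assoc: "gm (e # q) v * wm p w = gm q v * (ghost e * wm p w)" by (simp add: mult.assoc)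
  show ?case
  proof (cases "e = f")
    case True
    have eq: "gm (e # q) v * wm p w \<simeq> gm q v * wm p' w"
      unfolding assoc unfolding p True
      using Cons.prems p ghost_walk[of u' f p' w] awalk_gm_C[OF e(2)] by (intro eqv_mult_left) auto
    from Cons.IH[OF e(2) f(2)] Cons.prems p
    consider "gm q v * wm p' w \<in> T" |
      r where "p' = q @ r" "awalk v r w" "gm q v * wm p' w \<simeq> wm r w" by auto
    thus ?thesis
    proof cases
      case 1
      thus ?thesis using eq eqv_T by blast
    next
      case 2
      thus ?thesis using eq eqv_trans p True by auto
    qed
  next
    case False
    have "gm (e # q) v * wm p w \<in> T" unfolding assoc unfolding p
      using Cons.prems p False e awalk_gm_C[OF e(2)] by (intro T_mult_left ghost_walk_T) auto
    thus ?thesis by blast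
  qed
qed

lemma ghost_mon_walk_same:
  assumes "awalk u q v" shows "gm q v * wm q v \<simeq> vert v"
  using assms
proof (induction q arbitrary: u)
  case Nil
  thus ?case by (auto simp: awalk_Nil_iff vert_vert)
next
  case (Cons e q)
  have e: "awalk (head E e) q v" using Cons.prems by (auto simp: awalk_Cons_iff)
  have "gm (e # q) v * wm (e # q) v = gm q v * (ghost e * wm (e # q) v)" by (simp add: mult.assoc)
  also have "\<dots> \<simeq> gm q v * wm q v"
    by (intro eqv_mult_left ghost_walk[OF Cons.prems] awalk_gm_C[OF e])
  also have "\<dots> \<simeq> vert v" by (rule Cons.IH[OF e])
  finally show ?case .
qed

lemma exit_or_unitary:
  assumes "awalk v g v'"
  shows "wm g v' * gm g v' \<simeq> vert v \<or>
    (\<exists>\<mu> w. awalk v \<mu> w \<and> vert w \<notin> T \<and> gm \<mu> w * wm g v' \<in> T)"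
  using assms
proof (induction g arbitrary: v)
  case Nil
  thus ?case by (auto simp: awalk_Nil_iff vert_vert)
next
  case (Cons e g)
  have e: "e \<in> arcs E" "tail E e = v" "awalk (head E e) g v'" and v: "v \<in> verts E"
    using Cons.prems by (auto simp: awalk_Cons_iff)
  note gC = awalk_wm_C[OF e(3)] awalk_gm_C[OF e(3)]
  show ?case
  proof (cases "\<exists>f\<in>out_arcs E v. f \<noteq> e \<and> vert (head E f) \<notin> T")
    case True
    then obtain f where f: "f \<in> arcs E" "tail E f = v" "f \<noteq> e" "vert (head E f) \<notin> T" by auto
    have "vert (head E f) * (ghost f * wm (e # g) v') \<in> T"
      using f ghost_walk_T[OF Cons.prems f(1) f(3)] by (intro T_mult_left[of "ghost f * wm (e # g) v'"]) auto
    hence "gm [f] (head E f) * wm (e # g) v' \<in> T" by (simp add: mult.assoc)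
    moreover have "awalk v [f] (head E f)" using f by (auto simp: awalk_Cons_iff awalk_Nil_iff)
    ultimately show ?thesis using f by blast
  next
    case False
    \<comment> \<open>An edge absorbs its range vertex, so it vanishes together with that
      vertex.\<close>
    have zero: "edge f * ghost f \<in> T" if f: "f \<in> out_arcs E v" "f \<noteq> e" for f
    proof -
      have "edge f * vert (head E f) \<in> T" using f False by (intro T_mult_left) auto
      hence "edge f \<in> T" using eqv_T[OF edge_head[of f]] f by auto
      thus ?thesis using f by (intro T_mult_right) auto
    qed
    have out: "e \<in> out_arcs E v" "finite (out_arcs E v)" using e finite_out_arcs[OF v] by auto
    have "vert v \<simeq> (\<Sum>f\<in>out_arcs E v. edge f * ghost f)"
      by (rule sum_edge_ghost[OF v]) (use out in auto)
    also have "\<dots> \<simeq> (\<Sum>f\<in>out_arcs E v. if f = e then edge f * ghost f else 0)"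
      using zero T_eqv_zero by (intro eqv_sum) auto
    also have "\<dots> = edge e * ghost e" using out by (subst sum.delta) auto
    finally have ee: "vert v \<simeq> edge e * ghost e" .
    from Cons.IH[OF e(3)] show ?thesis
    proof
      assume *: "wm g v' * gm g v' \<simeq> vert (head E e)"
      have "wm (e # g) v' * gm (e # g) v' = edge e * (wm g v' * gm g v') * ghost e"
        by (simp add: mult.assoc)
      also have "\<dots> \<simeq> edge e * vert (head E e) * ghost e"
        using * e by (intro eqv_mult_right eqv_mult_left) auto
      also have "\<dots> \<simeq> edge e * ghost e"
        using e by (intro eqv_mult_right edge_head) auto
      also have "\<dots> \<simeq> vert v" by (rule eqv_sym[OF ee])
      finally show ?thesis ..
    next
      assume "\<exists>\<mu> w. awalk (head E e) \<mu> w \<and> vert w \<notin> T \<and> gm \<mu> w * wm g v' \<in> T"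
      then obtain \<mu> w where \<mu>: "awalk (head E e) \<mu> w" "vert w \<notin> T" "gm \<mu> w * wm g v' \<in> T" by blast
      have "gm (e # \<mu>) w * wm (e # g) v' = gm \<mu> w * (ghost e * wm (e # g) v')" by (simp add: mult.assoc)
      also have "\<dots> \<simeq> gm \<mu> w * wm g v'"
        by (intro eqv_mult_left ghost_walk[OF Cons.prems] awalk_gm_C[OF \<mu>(1)])
      finally have "gm (e # \<mu>) w * wm (e # g) v' \<in> T" using \<mu> eqv_T by blast
      moreover have "awalk v (e # \<mu>) w" using \<mu> e by (auto simp: awalk_Cons_iff)
      ultimately show ?thesis using \<mu> by blast
    qed
  qed
qed

section \<open>Comparison of degrees at a vertex\<close>

text \<open>An element is the finite sum of its components. This provides a lowest and a highest
  degree modulo \<open>T\<close>.\<close>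

lemma nonzero_comps:
  assumes "x \<in> C" "x \<notin> T"
  shows "finite {d. hom_comp d x \<notin> T}" "{d. hom_comp d x \<notin> T} \<noteq> {}"
proof -
  let ?D = "word_degree ` Poly_Mapping.keys x"
  have "hom_comp d x = 0" if "d \<notin> ?D" for d
    using that by (intro poly_mapping_eqI) (auto simp: hom_comp.rep_eq in_keys_iff)
  hence "{d. hom_comp d x \<notin> T} \<subseteq> ?D" by force
  thus "finite {d. hom_comp d x \<notin> T}" by (rule finite_subset) simp
  show "{d. hom_comp d x \<notin> T} \<noteq> {}"
    using T_sum[of ?D "\<lambda>d. hom_comp d x"] sum_hom_comp[of ?D x] assms(2) by auto
qed

lemma vert_eq_wm: "vert v = wm [] v"
  by simp

lemma hom_comp_vert: "hom_comp d (vert v) = (if d = 0 then vert v else 0)"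
  unfolding vert_eq_wm hom_comp_walk_mon by simp

lemma hom_comp_mult_vert: "hom_comp d (x * vert v) = hom_comp d x * vert v"
  unfolding vert_eq_wm hom_comp_mult_walk_mon by simp

text \<open>The walks form an indexed family, so conjugation can replace them without tracking
  whether they remain distinct, and progress is measured by the size of the index set.\<close>

definition mono_vert :: "'v \<Rightarrow> 'k \<Rightarrow> 'i set \<Rightarrow> ('i \<Rightarrow> 'k) \<Rightarrow> ('i \<Rightarrow> 'e list) \<Rightarrow>
    ('v, 'e) lpa_gen gen_word \<Rightarrow>\<^sub>0 'k" where
  "mono_vert v \<kappa> I k \<gamma> = scl \<kappa> * vert v + (\<Sum>i\<in>I. scl (k i) * wm (\<gamma> i) v)"

lemma hom_comp_mono_vert:
  assumes "\<And>i. i \<in> I \<Longrightarrow> \<gamma> i \<noteq> []"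
  shows "hom_comp 0 (mono_vert v \<kappa> I k \<gamma>) = scl \<kappa> * vert v"
    and "d < 0 \<Longrightarrow> hom_comp d (mono_vert v \<kappa> I k \<gamma>) = 0"
  using assms
  by (auto simp: mono_vert_def hom_comp_add hom_comp_sum hom_comp_scl hom_comp_walk_mon hom_comp_vert
      intro!: sum.neutral)

text \<open>Being graded, \<open>T\<close> would also contain the component of degree zero, which is
  \<open>\<kappa>\<close> times the vertex.\<close>

lemma mono_vert_not_T:
  assumes "\<And>i. i \<in> I \<Longrightarrow> \<gamma> i \<noteq> []" "\<kappa> \<noteq> 0" "vert v \<notin> T"
  shows "mono_vert v \<kappa> I k \<gamma> \<notin> T"
  using T_hom_comp[of "mono_vert v \<kappa> I k \<gamma>" 0] hom_comp_mono_vert(1)[of I \<gamma> v \<kappa> k] assms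
  by (auto simp: T_scl_iff)

text \<open>
  If \<open>g\<close> is a closed walk without exits, then \<open>v - g\<close> has no left inverse in the corner at \<open>v\<close>,
  by comparing the components of lowest and highest degree.
\<close>

lemma no_left_inverse:
  assumes v: "v \<in> verts E" "vert v \<notin> T" and g: "awalk v g v" "g \<noteq> []"
    and unitary: "wm g v * gm g v \<simeq> vert v" and a: "a \<in> C" "a * vert v \<simeq> a"
  shows "\<not> a * (vert v - wm g v) \<simeq> vert v"
proof
  assume inv: "a * (vert v - wm g v) \<simeq> vert v"
  let ?D = "{d. hom_comp d a \<notin> T}" and ?l = "int (length g)"
  note gC = awalk_wm_C[OF g(1)] awalk_gm_C[OF g(1)]
  have l: "?l > 0" using g(2) by simp
  have "a \<notin> T"
  proof
    assume "a \<in> T"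
    hence "a * (vert v - wm g v) \<in> T" using v gC by (intro T_mult_right free_algebra_diff) auto
    thus False using inv eqv_T v(2) by blast
  qed
  note D = nonzero_comps[OF a(1) this]
  \<comment> \<open>The component of degree \<open>d\<close> in \<open>a (v - g) = v\<close>;
    multiplication by \<open>g\<close> shifts degrees by its length.\<close>
  have comp: "hom_comp d a - hom_comp (d - ?l) a * wm g v \<simeq> (if d = 0 then vert v else 0)" for d
  proof -
    have "hom_comp d a - hom_comp (d - ?l) a * wm g v \<simeq>
        hom_comp d (a * vert v) - hom_comp (d - ?l) a * wm g v"
      using gC a by (intro eqv_diff eqv_sym[OF eqv_hom_comp] eqv_refl) auto
    also have "\<dots> = hom_comp d (a * (vert v - wm g v))"
      by (simp add: right_diff_distrib hom_comp_diff hom_comp_mult_walk_mon)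
    also have "\<dots> \<simeq> hom_comp d (vert v)" by (rule eqv_hom_comp[OF inv])
    finally show ?thesis by (simp add: hom_comp_vert)
  qed
  define d0 d1 where "d0 = Min ?D" and "d1 = Max ?D"
  have d0: "hom_comp d0 a \<notin> T" and d1: "hom_comp d1 a \<notin> T"
    using Min_in[OF D] Max_in[OF D] by (auto simp: d0_def d1_def)
  have below: "hom_comp d a \<in> T" if "d < d0" for d
    using Min_le[OF D(1), of d] that by (force simp: d0_def)
  have above: "hom_comp d a \<in> T" if "d > d1" for d
    using Max_ge[OF D(1), of d] that by (force simp: d1_def)
  \<comment> \<open>In degree \<open>d0\<close> the shifted term vanishes, so the surviving
    component of \<open>a\<close> forces a nonzero right-hand side.\<close>
  have "d0 = 0"
  proof (rule ccontr)
    assume "d0 \<noteq> 0"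
    hence "hom_comp d0 a - hom_comp (d0 - ?l) a * wm g v \<in> T" using comp[of d0] eqv_T by fastforce
    moreover have "hom_comp (d0 - ?l) a * wm g v \<in> T" using below l gC by (intro T_mult_right) auto
    ultimately show False using d0 T_add by fastforce
  qed
  moreover have "d0 \<le> d1" using below d1 by force
  \<comment> \<open>This degree is positive and exceeds \<open>d1\<close>, so only the shifted term
    remains in it and has to vanish. Cancelling \<open>g\<close> by \<open>g g* = v\<close> then
    makes the highest component of \<open>a\<close> vanish.\<close>
  ultimately have "d1 + ?l \<noteq> 0" using l by linarith
  hence "hom_comp (d1 + ?l) a - hom_comp d1 a * wm g v \<in> T" using comp[of "d1 + ?l"] eqv_T by fastforce
  moreover have "hom_comp (d1 + ?l) a \<in> T" using above l by simp
  ultimately have "hom_comp d1 a * wm g v \<in> T"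
    using T_diff[of "hom_comp (d1 + ?l) a" "hom_comp (d1 + ?l) a - hom_comp d1 a * wm g v"] by simp
  hence "hom_comp d1 a * (wm g v * gm g v) \<in> T"
    using gC T_mult_right by (fastforce simp: mult.assoc[symmetric])
  moreover have "hom_comp d1 a * (wm g v * gm g v) \<simeq> hom_comp d1 a * vert v"
    using a by (intro eqv_mult_left unitary) auto
  moreover have "hom_comp d1 a * vert v \<simeq> hom_comp d1 a"
    using eqv_hom_comp[OF a(2), of d1] by (simp add: hom_comp_mult_vert)
  ultimately show False using d1 eqv_T by blast
qed

text \<open>The walks have positive length, so in the lowest degree of \<open>z\<close> only the
  vertex term contributes to the product. The lemma allows a \<open>mono_vert\<close> to be
  cancelled on the right.\<close>

lemma annihilator_mono_vert:
  assumes \<gamma>: "\<And>i. i \<in> I \<Longrightarrow> awalk v (\<gamma> i) v \<and> \<gamma> i \<noteq> []"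
    and \<kappa>: "\<kappa> \<noteq> 0" and z: "z \<in> C" "z * vert v \<simeq> z" "z * mono_vert v \<kappa> I k \<gamma> \<in> T"
  shows "z \<in> T"
proof (rule ccontr)
  assume "z \<notin> T"
  note D = nonzero_comps[OF z(1) this]
  define d where "d = Min {d. hom_comp d z \<notin> T}"
  have d: "hom_comp d z \<notin> T" using Min_in[OF D] by (auto simp: d_def)
  have below: "hom_comp d' z \<in> T" if "d' < d" for d'
    using Min_le[OF D(1), of d'] that by (force simp: d_def)
  have "hom_comp d (z * mono_vert v \<kappa> I k \<gamma>) \<in> T" by (rule T_hom_comp[OF z(3)])
  also have "hom_comp d (z * mono_vert v \<kappa> I k \<gamma>) = scl \<kappa> * (hom_comp d z * vert v)
      + (\<Sum>i\<in>I. scl (k i) * (hom_comp (d - length (\<gamma> i)) z * wm (\<gamma> i) v))"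
    by (simp add: mono_vert_def distrib_left sum_distrib_left mult_scl_left hom_comp_add hom_comp_sum
        hom_comp_scl hom_comp_mult_walk_mon hom_comp_mult_vert)
  finally have "scl \<kappa> * (hom_comp d z * vert v)
      + (\<Sum>i\<in>I. scl (k i) * (hom_comp (d - length (\<gamma> i)) z * wm (\<gamma> i) v)) \<in> T" .
  moreover have "(\<Sum>i\<in>I. scl (k i) * (hom_comp (d - length (\<gamma> i)) z * wm (\<gamma> i) v)) \<in> T"
    using \<gamma> awalk_wm_C by (intro T_sum T_scl T_mult_right below) auto
  ultimately have "scl \<kappa> * (hom_comp d z * vert v) \<in> T" using T_diff by fastforce
  hence "hom_comp d z * vert v \<in> T" using \<kappa> T_scl_iff by blast
  moreover have "hom_comp d z * vert v \<simeq> hom_comp d z"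
    using eqv_hom_comp[OF z(2), of d] by (simp add: hom_comp_mult_vert)
  ultimately show False using d eqv_T by blast
qed

section \<open>From a minimal element to a vertex\<close>

abbreviation Min_T :: "(('v, 'e) lpa_gen gen_word \<Rightarrow>\<^sub>0 'k) set" where
  "Min_T \<equiv> minimal_mod (free_algebra (lpa_gens E)) T"

lemma Min_T_D: "x \<in> Min_T \<Longrightarrow> x \<in> C" "x \<in> Min_T \<Longrightarrow> x \<notin> T"
  by (auto simp: minimal_mod_def)

lemma Min_T_recover:
  assumes "x \<in> Min_T" "a \<in> C" "a * x \<notin> T" shows "\<exists>b\<in>C. b * (a * x) \<simeq> x"
proof -
  obtain b i where b: "b \<in> C" "i \<in> T" "b * (a * x) + i = x"
    using assms by (auto simp: minimal_mod_def)
  hence "b * (a * x) - x = - i" by (simp add: algebra_simps)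
  hence "b * (a * x) \<simeq> x" using b assms T_uminus[OF b(2)] Min_T_D by (auto simp: eqv_def)
  thus ?thesis using b by blast
qed

lemma Min_T_mult_left: "\<lbrakk>x \<in> Min_T; a \<in> C; a * x \<notin> T\<rbrakk> \<Longrightarrow> a * x \<in> Min_T"
  using nonunital_algebra.mult_minimal_mod_left[OF nonunital_algebra_free_algebra ideal, of x a] by simp

lemma Min_T_mult_right: "\<lbrakk>x \<in> Min_T; a \<in> C; x * a \<notin> T\<rbrakk> \<Longrightarrow> x * a \<in> Min_T"
  using nonunital_algebra.mult_minimal_mod_right[OF nonunital_algebra_free_algebra ideal, of x a] by simp

lemma mono_vert_C:
  assumes "v \<in> verts E" "\<And>i. i \<in> I \<Longrightarrow> awalk v (\<gamma> i) v"
  shows "mono_vert v \<kappa> I k \<gamma> \<in> C"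
  unfolding mono_vert_def using assms
  by (auto intro!: free_algebra_add free_algebra_sum free_algebra_scl intro: awalk_wm_C)

text \<open>Minimality yields \<open>b\<close> with \<open>b (v - g) y = y\<close>, where
  \<open>y\<close> is the \<open>mono_vert\<close> form of \<open>x\<close>. Cancelling
  \<open>y\<close> by \<open>annihilator_mono_vert\<close> leaves a left inverse of
  \<open>v - g\<close> in the corner at \<open>v\<close>, contrary to
  \<open>no_left_inverse\<close>.\<close>

lemma Min_T_not_unitary:
  assumes x: "x \<in> Min_T" "x \<simeq> mono_vert v \<kappa> I k \<gamma>" and \<kappa>: "\<kappa> \<noteq> 0"
    and v: "v \<in> verts E" "vert v \<notin> T"
    and \<gamma>: "\<And>i. i \<in> I \<Longrightarrow> awalk v (\<gamma> i) v \<and> \<gamma> i \<noteq> []"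
    and g: "awalk v g v" "g \<noteq> []"
  shows "\<not> wm g v * gm g v \<simeq> vert v"
proof
  assume unitary: "wm g v * gm g v \<simeq> vert v"
  let ?y = "mono_vert v \<kappa> I k \<gamma>" and ?q = "vert v - wm g v"
  have yC: "?y \<in> C" and gC: "wm g v \<in> C" and qC: "?q \<in> C"
    using mono_vert_C[OF v(1), of I \<gamma> \<kappa> k] v \<gamma> awalk_wm_C[OF g(1)] by auto
  have vy: "vert v * ?y \<simeq> ?y"
  proof -
    have "vert v * ?y = scl \<kappa> * (vert v * vert v) + (\<Sum>i\<in>I. scl (k i) * (vert v * wm (\<gamma> i) v))"
      by (simp add: mono_vert_def distrib_left sum_distrib_left mult_scl_left)
    also have "\<dots> \<simeq> ?y" unfolding mono_vert_def
      using \<gamma> v by (intro eqv_add eqv_sum eqv_scl vert_vert vert_walk) auto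
    finally show ?thesis .
  qed
  \<comment> \<open>Otherwise \<open>y\<close> is congruent to \<open>g y\<close>, all of whose
    terms have positive degree, while the component of \<open>y\<close> in degree zero is a nonzero
    multiple of \<open>v\<close>.\<close>
  have "?q * ?y \<notin> T"
  proof
    assume "?q * ?y \<in> T"
    have "?y \<simeq> wm g v * ?y"
    proof -
      have "?y \<simeq> vert v * ?y" by (rule eqv_sym[OF vy])
      also have "\<dots> = ?q * ?y + wm g v * ?y" by (simp add: algebra_simps)
      also have "\<dots> \<simeq> 0 + wm g v * ?y"
        using \<open>?q * ?y \<in> T\<close> yC gC by (intro eqv_add T_eqv_zero eqv_refl) auto
      finally show ?thesis by simp
    qed
    from eqv_hom_comp[OF this, of 0] have "scl \<kappa> * vert v \<simeq> 0"
      using g(2) \<gamma> by (simp add: hom_comp_walk_mon_mult hom_comp_mono_vert)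
    thus False using \<kappa> v(2) eqv_T T_scl_iff by fastforce
  qed
  hence "?q * x \<notin> T" using eqv_T[OF eqv_mult_left[OF x(2) qC]] by simp
  then obtain b where b: "b \<in> C" "b * (?q * x) \<simeq> x"
    using Min_T_recover[OF x(1) qC] by blast
  have bqy: "b * (?q * ?y) \<simeq> ?y"
  proof -
    have "b * (?q * ?y) \<simeq> b * (?q * x)"
      using b qC by (intro eqv_mult_left eqv_sym[OF x(2)]) auto
    also have "\<dots> \<simeq> x" by (rule b(2))
    also have "\<dots> \<simeq> ?y" by (rule x(2))
    finally show ?thesis .
  qed
  \<comment> \<open>\<open>b\<close> is cut down to the corner at \<open>v\<close>. This does no
    harm since \<open>?q\<close> and \<open>?y\<close> both start at \<open>v\<close>.\<close>
  let ?a = "vert v * b * vert v"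
  have aC: "?a \<in> C" using b v by auto
  have av: "?a * vert v \<simeq> ?a"
    using eqv_mult_left[OF vert_vert[OF v(1)], of "vert v * b"] b v by (simp add: mult.assoc)
  have vq: "vert v * ?q \<simeq> ?q"
    unfolding right_diff_distrib using v g by (intro eqv_diff vert_vert vert_walk) auto
  have qv: "?q * vert v \<simeq> ?q"
    unfolding left_diff_distrib using v g by (intro eqv_diff vert_vert walk_vert) auto
  \<comment> \<open>The defect of \<open>?a\<close> as a left inverse of \<open>?q\<close>; it
    annihilates \<open>?y\<close> on the left and hence vanishes.\<close>
  let ?z = "?a * ?q - vert v"
  have zC: "?z \<in> C" using aC qC v by (intro free_algebra_diff[OF free_algebra_mult]) auto
  have "?a * (?q * ?y) = vert v * (b * ((vert v * ?q) * ?y))" by (simp add: mult.assoc)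
  also have "\<dots> \<simeq> vert v * (b * (?q * ?y))"
    using v b yC by (intro eqv_mult_left eqv_mult_right vq) auto
  also have "\<dots> \<simeq> vert v * ?y" using v by (intro eqv_mult_left bqy) auto
  finally have "?a * (?q * ?y) \<simeq> vert v * ?y" .
  hence zy: "?z * ?y \<in> T" by (simp add: eqv_def left_diff_distrib mult.assoc)
  have zv: "?z * vert v \<simeq> ?z"
  proof -
    have "?z * vert v = ?a * (?q * vert v) - vert v * vert v"
      by (simp add: left_diff_distrib mult.assoc)
    also have "\<dots> \<simeq> ?z" using aC v by (intro eqv_diff eqv_mult_left qv vert_vert) auto
    finally show ?thesis .
  qed
  have "?z \<in> T" by (rule annihilator_mono_vert[OF \<gamma> \<kappa> zC zv zy])
  hence "?a * ?q \<simeq> vert v" unfolding eqv_def using free_algebra_mult[OF aC qC] v by simp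
  with no_left_inverse[OF v g unitary aC av] show False ..
qed

lemma eqv_sum_subset:
  assumes "finite I" "J \<subseteq> I" "\<And>i. i \<in> I - J \<Longrightarrow> f i \<in> T" "\<And>i. i \<in> J \<Longrightarrow> f i \<simeq> h i"
  shows "(\<Sum>i\<in>I. scl (k i) * f i) \<simeq> (\<Sum>i\<in>J. scl (k i) * h i)"
proof -
  have "(\<Sum>i\<in>I. scl (k i) * f i) = (\<Sum>i\<in>I - J. scl (k i) * f i) + (\<Sum>i\<in>J. scl (k i) * f i)"
    by (rule sum.subset_diff[OF assms(2,1)])
  also have "\<dots> \<simeq> 0 + (\<Sum>i\<in>J. scl (k i) * h i)"
    using assms(3,4) by (intro eqv_add eqv_sum eqv_scl T_eqv_zero T_sum T_scl) auto
  finally show ?thesis by simp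
qed

text \<open>
  Conjugating by an exit of one of the closed walks annihilates that walk, so the number of terms
  drops until only a multiple of a vertex is left.
\<close>

lemma mono_vert_reduce:
  assumes "finite I" and "x \<in> Min_T" "x \<simeq> mono_vert v \<kappa> I k \<gamma>" and "\<kappa> \<noteq> 0"
    and "v \<in> verts E" "vert v \<notin> T"
    and "\<And>i. i \<in> I \<Longrightarrow> awalk v (\<gamma> i) v \<and> \<gamma> i \<noteq> []"
  shows "\<exists>w\<in>verts E. vert w \<notin> T \<and> (\<exists>a\<in>C. \<exists>b\<in>C. a * x * b \<simeq> vert w)"
  using assms
proof (induction "card I" arbitrary: I x v \<gamma> rule: less_induct)
  case less
  note v = less.prems(5,6) and \<gamma> = less.prems(7) and \<kappa> = less.prems(4) and x = less.prems(2,3)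
  show ?case
  proof (cases "I = {}")
    case True
    let ?a = "scl (inverse \<kappa>) * vert v"
    have aC: "?a \<in> C" using v by auto
    have "?a * x * vert v \<simeq> ?a * (scl \<kappa> * vert v) * vert v"
      using x(2) True v aC by (intro eqv_mult_right eqv_mult_left) (auto simp: mono_vert_def)
    also have "\<dots> = vert v * vert v * vert v"
      using \<kappa> by (simp only: mult.assoc mult_scl_left[of "vert v"] scl_mult_scl) simp
    also have "\<dots> \<simeq> vert v * vert v" using v by (intro eqv_mult_right vert_vert) auto
    also have "\<dots> \<simeq> vert v" using v by (intro vert_vert) auto
    finally show ?thesis using v aC by (intro bexI[of _ v] conjI bexI[of _ ?a] bexI[of _ "vert v"]) auto
  next
    case False
    then obtain i0 where i0: "i0 \<in> I" by blast
    \<comment> \<open>This is where minimality enters: it rules out the first alternative of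
      \<open>exit_or_unitary\<close>.\<close>
    have "\<not> wm (\<gamma> i0) v * gm (\<gamma> i0) v \<simeq> vert v"
      using Min_T_not_unitary[OF x \<kappa> v \<gamma>] \<gamma>[OF i0] by blast
    then obtain \<mu> w where \<mu>: "awalk v \<mu> w" "vert w \<notin> T" "gm \<mu> w * wm (\<gamma> i0) v \<in> T"
      using exit_or_unitary[of v "\<gamma> i0" v] \<gamma>[OF i0] by blast
    have w: "w \<in> verts E" using \<mu> by auto
    note \<mu>C = awalk_wm_C[OF \<mu>(1)] awalk_gm_C[OF \<mu>(1)]
    let ?x = "gm \<mu> w * x * wm \<mu> w"
    let ?f = "\<lambda>i. gm \<mu> w * wm (\<gamma> i) v * wm \<mu> w"
    let ?J = "{i \<in> I. ?f i \<notin> T}"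
    have "?f i0 \<in> T" by (rule T_mult_right[OF \<mu>(3) \<mu>C(1)])
    hence J: "?J \<subset> I" using i0 by blast
    have "\<exists>r. awalk w r w \<and> r \<noteq> [] \<and> ?f i \<simeq> wm r w" if i: "i \<in> ?J" for i
    proof -
      have \<gamma>i: "awalk v (\<gamma> i) v" "\<gamma> i \<noteq> []" using \<gamma> i by auto
      have app: "awalk v (\<gamma> i @ \<mu>) w" using \<gamma>i \<mu> by auto
      have "?f i = gm \<mu> w * (wm (\<gamma> i) v * wm \<mu> w)" by (simp add: mult.assoc)
      also have "\<dots> \<simeq> gm \<mu> w * wm (\<gamma> i @ \<mu>) w"
        using \<gamma>i \<mu> \<mu>C by (intro eqv_mult_left walk_append) auto
      finally have eq: "?f i \<simeq> gm \<mu> w * wm (\<gamma> i @ \<mu>) w" .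
      hence "gm \<mu> w * wm (\<gamma> i @ \<mu>) w \<notin> T" using i eqv_T by blast
      then obtain r where r: "\<gamma> i @ \<mu> = \<mu> @ r" "awalk w r w" "gm \<mu> w * wm (\<gamma> i @ \<mu>) w \<simeq> wm r w"
        using ghost_mon_walk[OF \<mu>(1) app] by auto
      \<comment> \<open>From \<open>\<gamma> i @ \<mu> = \<mu> @ r\<close>: conjugation preserves
        the length, so the new closed walk at \<open>w\<close> is again nontrivial.\<close>
      have "length r = length (\<gamma> i)" using arg_cong[OF r(1), of length] by simp
      thus ?thesis using r eqv_trans[OF eq] \<gamma>i by auto
    qed
    hence "\<exists>r. \<forall>i\<in>?J. awalk w (r i) w \<and> r i \<noteq> [] \<and> ?f i \<simeq> wm (r i) w"
      by (intro bchoice ballI)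
    then obtain r where r: "\<And>i. i \<in> ?J \<Longrightarrow> awalk w (r i) w \<and> r i \<noteq> [] \<and> ?f i \<simeq> wm (r i) w"
      by blast
    have "?x \<simeq> gm \<mu> w * mono_vert v \<kappa> I k \<gamma> * wm \<mu> w"
      using \<mu>C by (intro eqv_mult_right eqv_mult_left x)
    also have "\<dots> = scl \<kappa> * (gm \<mu> w * (vert v * wm \<mu> w)) + (\<Sum>i\<in>I. scl (k i) * ?f i)"
      by (simp add: mono_vert_def distrib_left distrib_right sum_distrib_left sum_distrib_right
          mult_scl_left mult.assoc)
    \<comment> \<open>The vertex term survives with its coefficient, since \<open>\<mu>\<close> and
      its ghost multiply to \<open>w\<close>; the term of \<open>i0\<close> is among those
      dropped.\<close>
    also have "\<dots> \<simeq> scl \<kappa> * (gm \<mu> w * wm \<mu> w) + (\<Sum>i\<in>?J. scl (k i) * wm (r i) w)"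
      using less.prems(1) r \<mu> \<mu>C
      by (intro eqv_add eqv_scl eqv_mult_left vert_walk eqv_sum_subset) auto
    also have "\<dots> \<simeq> mono_vert w \<kappa> ?J k r"
      unfolding mono_vert_def using r
      by (intro eqv_add eqv_scl ghost_mon_walk_same[OF \<mu>(1)] eqv_refl free_algebra_sum free_algebra_scl)
        (auto intro: awalk_wm_C)
    finally have eq: "?x \<simeq> mono_vert w \<kappa> ?J k r" .
    hence xT: "?x \<notin> T" using mono_vert_not_T[of ?J r \<kappa> w k] r \<kappa> \<mu>(2) eqv_T by blast
    hence "gm \<mu> w * x \<notin> T" using T_mult_right \<mu>C by blast
    hence "?x \<in> Min_T" using xT x \<mu>C by (intro Min_T_mult_right Min_T_mult_left)
    hence "\<exists>w'\<in>verts E. vert w' \<notin> T \<and> (\<exists>a\<in>C. \<exists>b\<in>C. a * ?x * b \<simeq> vert w')"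
      using less.hyps[OF psubset_card_mono[OF less.prems(1) J] _ _ eq \<kappa> w \<mu>(2)] r less.prems(1) by auto
    then obtain w' a b where *: "w' \<in> verts E" "vert w' \<notin> T" "a \<in> C" "b \<in> C" "a * ?x * b \<simeq> vert w'"
      by blast
    have "(a * gm \<mu> w) * x * (wm \<mu> w * b) \<simeq> vert w'" using *(5) by (simp add: mult.assoc)
    thus ?thesis using * \<mu>C by (meson free_algebra_mult)
  qed
qed

section \<open>Removal of ghost edges\<close>

definition ghosts :: "('v, 'e) lpa_gen list \<Rightarrow> nat" where
  "ghosts l = length (filter (\<lambda>g. \<exists>e. g = Ghost e) l)"

text \<open>A walk is long enough for \<open>k\<close> if \<open>k\<close> ghost edges cannot use it up, or if it ends in a sink.\<close>

definition long_walk :: "nat \<Rightarrow> 'e list \<Rightarrow> 'v \<Rightarrow> bool" where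
  "long_walk k p v \<longleftrightarrow> k \<le> length p \<or> out_arcs E v = {}"

text \<open>The letters act on the walk starting from the right end of the word: a vertex tests the
  start of the walk, an edge is prepended, and a ghost edge strips the first edge or gives zero. The
  parameter \<open>k\<close> reserves length for ghost edges still to come from the left.\<close>

lemma word_walk:
  assumes "set l \<subseteq> lpa_gens E" "awalk u p v" "long_walk (ghosts l + k) p v"
  shows "word_mon l * wm p v \<in> T \<or>
    (\<exists>u' q. awalk u' q v \<and> long_walk k q v \<and> word_mon l * wm p v \<simeq> wm q v)"
  using assms
proof (induction l arbitrary: k)
  case Nil
  thus ?case using awalk_wm_C[OF Nil(2)]
    by (intro disjI2 exI[of _ u] exI[of _ p]) (auto simp: ghosts_def word_mon_Nil)
next
  case (Cons g l)
  have g: "g \<in> lpa_gens E" "set l \<subseteq> lpa_gens E" using Cons.prems by auto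
  have mon: "word_mon (g # l) * wm p v = free_gen g * (word_mon l * wm p v)"
    by (simp add: word_mon_Cons mult.assoc)
  \<comment> \<open>If \<open>g\<close> is a ghost edge, the walk left over by \<open>l\<close> must
    have one edge to spare for it.\<close>
  let ?k = "if \<exists>e. g = Ghost e then Suc k else k"
  have "long_walk (ghosts l + ?k) p v"
    using Cons.prems(3) by (auto simp: ghosts_def)
  from Cons.IH[OF g(2) Cons.prems(2) this] show ?case
  proof (elim disjE exE conjE)
    assume "word_mon l * wm p v \<in> T"
    thus ?case unfolding mon by (intro disjI1 T_mult_left[of "word_mon l * wm p v"] gen_C g)
  next
    fix u' q assume q: "awalk u' q v" "long_walk ?k q v" "word_mon l * wm p v \<simeq> wm q v"
    have eq: "word_mon (g # l) * wm p v \<simeq> free_gen g * wm q v"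
      unfolding mon by (rule eqv_mult_left[OF q(3)]) (use g in simp)
    have done_T: ?case if "free_gen g * wm q v \<in> T" using that eq eqv_T by blast
    have done_walk: ?case
      if "awalk u'' q' v" "long_walk k q' v" "free_gen g * wm q v \<simeq> wm q' v" for u'' q'
      using that eq eqv_trans by blast
    from g(1) show ?case
    proof (cases rule: gens_cases)
      case (1 w)
      show ?thesis
      proof (cases "w = u'")
        case True
        thus ?thesis using done_walk[OF q(1)] q(2) vert_walk[OF q(1)] 1 by auto
      next
        case False
        thus ?thesis using done_T vert_walk_T[OF q(1)] 1 by auto
      qed
    next
      case (2 e)
      show ?thesis
      proof (cases "head E e = u'")
        case True
        hence e: "awalk (tail E e) (e # q) v" using q 2 by (auto simp: awalk_Cons_iff)
        have "long_walk k (e # q) v" using q(2) 2 by (auto simp: long_walk_def)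
        thus ?thesis using done_walk[OF e] awalk_wm_C[OF e] 2 by auto
      next
        case False
        thus ?thesis using done_T edge_walk_T[OF _ q(1)] 2 by auto
      qed
    next
      case (3 e)
      show ?thesis
      proof (cases q)
        case Nil
        \<comment> \<open>A trivial walk meets a ghost edge only at a sink, where the ghost edge
          cannot end, so the product is zero.\<close>
        hence "out_arcs E v = {}" using q(2) 3 by (auto simp: long_walk_def)
        hence "tail E e \<noteq> v" using 3 by auto
        hence "free_gen g * vert v \<in> T" using 3 g q by (intro gen_vert_T) auto
        thus ?thesis using done_T Nil by simp
      next
        case (Cons f q')
        have q': "awalk (head E f) q' v" using q Cons by (auto simp: awalk_Cons_iff)
        have long: "long_walk k q' v" using q(2) 3 Cons by (auto simp: long_walk_def)
        show ?thesis
        proof (cases "e = f")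
          case True
          thus ?thesis using done_walk[OF q' long] ghost_walk[of u' f q' v] q(1) Cons 3 by auto
        next
          case False
          thus ?thesis using done_T ghost_walk_T[of u' f q' v e] q(1) Cons 3 by auto
        qed
      qed
    qed
  qed
qed

text \<open>Inserting \<open>CK2\<close> at the end of the walk writes the product as a sum over the
  edges leaving there; some summand is nonzero, and its edge prolongs the walk. The process may halt
  only at a sink.\<close>

lemma long_walk_exists:
  assumes x: "x \<in> C" "x \<notin> T"
  shows "\<exists>u p v. awalk u p v \<and> long_walk m p v \<and> x * wm p v \<notin> T"
proof (induction m)
  case 0
  obtain v where "v \<in> verts E" "x * vert v \<notin> T" using right_vert[OF x] by blast
  thus ?case by (intro exI[of _ v] exI[of _ "[]"]) (auto simp: awalk_Nil_iff long_walk_def)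
next
  case (Suc m)
  then obtain u p v where p: "awalk u p v" "long_walk m p v" "x * wm p v \<notin> T" by blast
  have v: "v \<in> verts E" using p by auto
  show ?case
  proof (cases "out_arcs E v = {}")
    case True
    thus ?thesis using p by (auto simp: long_walk_def)
  next
    case False
    have "x * wm p v \<simeq> x * (wm p v * vert v)"
      using p x v by (intro eqv_mult_left eqv_sym[OF walk_vert]) auto
    also have "\<dots> \<simeq> x * (wm p v * (\<Sum>e\<in>out_arcs E v. edge e * ghost e))"
      using awalk_wm_C[OF p(1)] x by (intro eqv_mult_left sum_edge_ghost v False)
    also have "\<dots> = (\<Sum>e\<in>out_arcs E v. (x * wm p v * edge e) * ghost e)"
      by (simp add: sum_distrib_left mult.assoc)
    finally have "(\<Sum>e\<in>out_arcs E v. (x * wm p v * edge e) * ghost e) \<notin> T" using p(3) eqv_T by blast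
    hence "\<not> (\<forall>e\<in>out_arcs E v. (x * wm p v * edge e) * ghost e \<in> T)"
      using T_sum[of "out_arcs E v" "\<lambda>e. (x * wm p v * edge e) * ghost e"] by metis
    then obtain e where e: "e \<in> arcs E" "tail E e = v" "(x * wm p v * edge e) * ghost e \<notin> T"
      using out_arcs_arcs by blast
    hence *: "x * wm p v * edge e \<notin> T" using T_mult_right by auto
    have ew: "awalk v [e] (head E e)" using e by (auto simp: awalk_Cons_iff awalk_Nil_iff)
    have "x * wm p v * edge e = x * (wm p v * edge e)" by (simp add: mult.assoc)
    also have "\<dots> \<simeq> x * (wm p v * wm [e] (head E e))"
      using eqv_sym[OF edge_head[OF e(1)]] awalk_wm_C[OF p(1)] x by (intro eqv_mult_left) auto
    also have "\<dots> \<simeq> x * wm (p @ [e]) (head E e)"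
      using p ew x by (intro eqv_mult_left walk_append) auto
    finally have "x * wm (p @ [e]) (head E e) \<notin> T" using * eqv_T by blast
    moreover have "awalk u (p @ [e]) (head E e)" using p ew by auto
    moreover have "long_walk (Suc m) (p @ [e]) (head E e)"
      using p(2) False by (auto simp: long_walk_def)
    ultimately show ?thesis by blast
  qed
qed

text \<open>A walk long enough for every word of \<open>x\<close> turns each word into a walk or
  zero. Equal walks are collected and zero coefficients discarded, so that later a shortest walk
  occurs once, with nonzero coefficient.\<close>

lemma mult_walk_real:
  assumes x: "x \<in> C" "x \<notin> T"
  shows "\<exists>u p v P k. awalk u p v \<and> x * wm p v \<notin> T \<and> finite P \<and>
    (\<forall>q\<in>P. k q \<noteq> 0 \<and> (\<exists>u. awalk u q v)) \<and> x * wm p v \<simeq> (\<Sum>q\<in>P. scl (k q) * wm q v)"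
proof -
  \<comment> \<open>The largest number of ghost edges in a word of \<open>x\<close>; inserting 0
    keeps the set nonempty.\<close>
  define m where "m = Max (insert 0 ((\<lambda>w. ghosts (letters w)) ` Poly_Mapping.keys x))"
  obtain u p v where p: "awalk u p v" "long_walk m p v" "x * wm p v \<notin> T"
    using long_walk_exists[OF x] by blast
  let ?W = "{w \<in> Poly_Mapping.keys x. word_mon (letters w) * wm p v \<notin> T}"
  have "\<exists>q. (\<exists>u. awalk u q v) \<and> word_mon (letters w) * wm p v \<simeq> wm q v" if w: "w \<in> ?W" for w
  proof -
    have "ghosts (letters w) \<le> m" unfolding m_def using w by (intro Max_ge) auto
    hence "long_walk (ghosts (letters w) + 0) p v" using p(2) by (auto simp: long_walk_def)
    from word_walk[OF _ p(1) this] C_keys(2)[OF x(1), of w] w show ?thesis by blast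
  qed
  hence "\<exists>g. \<forall>w\<in>?W. (\<exists>u. awalk u (g w) v) \<and> word_mon (letters w) * wm p v \<simeq> wm (g w) v"
    by (intro bchoice ballI)
  then obtain g where g: "\<And>w. w \<in> ?W \<Longrightarrow> (\<exists>u. awalk u (g w) v) \<and>
      word_mon (letters w) * wm p v \<simeq> wm (g w) v"
    by blast
  \<comment> \<open>Different words may yield the same walk; their coefficients add up and may
    cancel.\<close>
  define k where "k q = (\<Sum>w\<in>{w \<in> ?W. g w = q}. Poly_Mapping.lookup x w)" for q
  let ?P = "{q \<in> g ` ?W. k q \<noteq> 0}"
  have fin: "finite ?W" by simp
  have "x * wm p v = (\<Sum>w\<in>Poly_Mapping.keys x.
      scl (Poly_Mapping.lookup x w) * (word_mon (letters w) * wm p v))"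
    by (subst C_sum_words[of x]) (simp only: sum_distrib_right mult.assoc)
  also have "\<dots> \<simeq> (\<Sum>w\<in>?W. scl (Poly_Mapping.lookup x w) * wm (g w) v)"
    using g by (intro eqv_sum_subset) auto
  also have "\<dots> = (\<Sum>q\<in>g ` ?W. \<Sum>w\<in>{w \<in> ?W. g w = q}. scl (Poly_Mapping.lookup x w) * wm (g w) v)"
    by (rule sum.image_gen[OF fin])
  also have "\<dots> = (\<Sum>q\<in>g ` ?W. scl (k q) * wm q v)"
  proof (rule sum.cong[OF refl])
    fix q
    have "(\<Sum>w\<in>S. scl (Poly_Mapping.lookup x w) :: ('v, 'e) lpa_gen gen_word \<Rightarrow>\<^sub>0 'k)
        = scl (\<Sum>w\<in>S. Poly_Mapping.lookup x w)" for S
      by (induction S rule: infinite_finite_induct) (auto simp: single_add)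
    moreover have "(\<Sum>w\<in>{w \<in> ?W. g w = q}. scl (Poly_Mapping.lookup x w) * wm (g w) v) =
        (\<Sum>w\<in>{w \<in> ?W. g w = q}. scl (Poly_Mapping.lookup x w)) * wm q v"
      unfolding sum_distrib_right by (rule sum.cong) auto
    ultimately show "(\<Sum>w\<in>{w \<in> ?W. g w = q}. scl (Poly_Mapping.lookup x w) * wm (g w) v) =
        scl (k q) * wm q v"
      by (simp only: k_def)
  qed
  also have "\<dots> = (\<Sum>q\<in>?P. scl (k q) * wm q v)"
    using fin by (intro sum.mono_neutral_right) auto
  finally have "x * wm p v \<simeq> (\<Sum>q\<in>?P. scl (k q) * wm q v)" .
  moreover have "finite ?P" using fin by simp
  moreover have "\<forall>q\<in>?P. k q \<noteq> 0 \<and> (\<exists>u. awalk u q v)" using g by blast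
  ultimately show ?thesis using p(1,3) by blast
qed

text \<open>After multiplication by a walk, the ghost of a shortest walk \<open>\<alpha>\<close>
  among the terms turns \<open>\<alpha>\<close> into the vertex \<open>v\<close> and every other
  term into zero or a nontrivial closed walk. This is the form that \<open>mono_vert_reduce\<close>
  expects.\<close>

theorem Min_T_vertex:
  assumes x: "x \<in> Min_T"
  shows "\<exists>w\<in>verts E. vert w \<notin> T \<and> (\<exists>a\<in>C. \<exists>b\<in>C. a * x * b \<simeq> vert w)"
proof -
  from mult_walk_real[OF Min_T_D[OF x]]
  obtain u p v P k where p: "awalk u p v" "x * wm p v \<notin> T" and P: "finite P"
    "\<forall>q\<in>P. k q \<noteq> 0 \<and> (\<exists>u. awalk u q v)"
    and eq: "x * wm p v \<simeq> (\<Sum>q\<in>P. scl (k q) * wm q v)"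
    by (elim exE conjE)
  have v: "v \<in> verts E" using p by auto
  note pC = awalk_wm_C[OF p(1)]
  \<comment> \<open>The product with the walk is nonzero and absorbs the end vertex of the
    walk.\<close>
  have vT: "vert v \<notin> T"
  proof
    assume "vert v \<in> T"
    hence "x * (wm p v * vert v) \<in> T" using Min_T_D(1)[OF x] pC by (intro T_mult_left) auto
    moreover have "x * (wm p v * vert v) \<simeq> x * wm p v"
      using Min_T_D(1)[OF x] p v by (intro eqv_mult_left walk_vert) auto
    ultimately show False using p(2) eqv_T by blast
  qed
  have "P \<noteq> {}" using eq p(2) eqv_T by fastforce
  \<comment> \<open>Minimal length is what \<open>ghost_mon_walk\<close> requires against every
    other walk in \<open>P\<close>; the remainders are nontrivial because those walks differ from
    \<open>\<alpha>\<close>.\<close>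
  then obtain \<alpha> where \<alpha>: "\<alpha> \<in> P" "\<And>q. q \<in> P \<Longrightarrow> length \<alpha> \<le> length q"
    using arg_min_if_finite[OF P(1), of length] by (meson not_le)
  obtain u' where \<alpha>w: "awalk u' \<alpha> v" using P(2) \<alpha>(1) by blast
  note \<alpha>C = awalk_gm_C[OF \<alpha>w]
  let ?f = "\<lambda>q. gm \<alpha> v * wm q v"
  let ?Q = "{q \<in> P - {\<alpha>}. ?f q \<notin> T}"
  have "\<exists>r. awalk v r v \<and> r \<noteq> [] \<and> ?f q \<simeq> wm r v" if q: "q \<in> ?Q" for q
  proof -
    obtain u'' where "awalk u'' q v" using P(2) q by blast
    then obtain r where "q = \<alpha> @ r" "awalk v r v" "?f q \<simeq> wm r v"
      using ghost_mon_walk[OF \<alpha>w, of u'' q v] \<alpha>(2) q by auto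
    thus ?thesis using q by auto
  qed
  hence "\<exists>r. \<forall>q\<in>?Q. awalk v (r q) v \<and> r q \<noteq> [] \<and> ?f q \<simeq> wm (r q) v"
    by (intro bchoice ballI)
  then obtain r where r: "\<And>q. q \<in> ?Q \<Longrightarrow> awalk v (r q) v \<and> r q \<noteq> [] \<and> ?f q \<simeq> wm (r q) v"
    by blast
  let ?x = "gm \<alpha> v * (x * wm p v)"
  have "?x \<simeq> gm \<alpha> v * (\<Sum>q\<in>P. scl (k q) * wm q v)" by (rule eqv_mult_left[OF eq \<alpha>C])
  also have "\<dots> = (\<Sum>q\<in>P. scl (k q) * ?f q)" by (simp add: sum_distrib_left mult_scl_left)
  also have "\<dots> = scl (k \<alpha>) * ?f \<alpha> + (\<Sum>q\<in>P - {\<alpha>}. scl (k q) * ?f q)"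
    by (rule sum.remove[OF P(1) \<alpha>(1)])
  also have "\<dots> \<simeq> mono_vert v (k \<alpha>) ?Q k r"
    unfolding mono_vert_def using P(1) r
    by (intro eqv_add eqv_scl ghost_mon_walk_same[OF \<alpha>w] eqv_sum_subset) auto
  finally have xeq: "?x \<simeq> mono_vert v (k \<alpha>) ?Q k r" .
  have k\<alpha>: "k \<alpha> \<noteq> 0" using P(2) \<alpha>(1) by blast
  have "?x \<notin> T" using mono_vert_not_T[of ?Q r "k \<alpha>" v k] r k\<alpha> vT eqv_T[OF xeq] by blast
  hence "?x \<in> Min_T" using x pC \<alpha>C p(2) by (intro Min_T_mult_left Min_T_mult_right)
  from mono_vert_reduce[OF _ this xeq k\<alpha> v vT] r P(1)
  obtain w a b where *: "w \<in> verts E" "vert w \<notin> T" "a \<in> C" "b \<in> C" "a * ?x * b \<simeq> vert w"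
    by auto
  have "(a * gm \<alpha> v) * x * (wm p v * b) \<simeq> vert w" using *(5) by (simp add: mult.assoc)
  thus ?thesis using * \<alpha>C pC by (meson free_algebra_mult)
qed

end

section \<open>The socle series is generated by vertices\<close>

text \<open>The vertex \<open>w = a x b\<close> lies in the next term because that term is a
  two-sided ideal. Conversely \<open>w a x\<close> is a nonzero multiple of \<open>x\<close>, from
  which minimality recovers \<open>x\<close>.\<close>

theorem (in graded_lpa_quotient) socle_step_vertices:
  "socle_step (free_algebra (lpa_gens E)) T =
     alg_ideal_gen (free_algebra (lpa_gens E))
       (T \<union> vert ` {v \<in> verts E. vert v \<in> socle_step (free_algebra (lpa_gens E)) T})"
    (is "?S = alg_ideal_gen ?A ?Y")
proof
  interpret nonunital_algebra ?A by (rule nonunital_algebra_free_algebra)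
  have S: "alg_ideal ?A ?S" by (rule alg_ideal_socle_step[OF ideal])
  note S' = S[unfolded alg_ideal_free_algebra_iff]
  have sup: "T \<union> Min_T \<subseteq> ?S" by (rule socle_step_superset[OF ideal])
  have "?Y \<subseteq> C" using T_C by auto
  hence G: "alg_ideal ?A (alg_ideal_gen ?A ?Y)" by (rule alg_ideal_gen_ideal)
  note G' = G[unfolded alg_ideal_free_algebra_iff]
  have YG: "?Y \<subseteq> alg_ideal_gen ?A ?Y" by (rule alg_ideal_gen_superset)
  show "alg_ideal_gen ?A ?Y \<subseteq> ?S" by (rule alg_ideal_gen_least[OF S]) (use sup in auto)
  have "x \<in> alg_ideal_gen ?A ?Y" if x: "x \<in> Min_T" for x
  proof -
    obtain w a b where w: "w \<in> verts E" "vert w \<notin> T" and ab: "a \<in> C" "b \<in> C" "a * x * b \<simeq> vert w"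
      using Min_T_vertex[OF x] by blast
    have xC: "x \<in> C" by (rule Min_T_D(1)[OF x])
    have "a * x * b \<in> ?S" using S' sup x ab by blast
    \<comment> \<open>\<open>vert w\<close> is \<open>a * x * b\<close> plus a scalar multiple of an
      element of \<open>T\<close>, in terms of the operations under which an ideal is
      closed.\<close>
    moreover have "scl (- 1) * (a * x * b - vert w) \<in> ?S"
      using S' sup ab(3) unfolding eqv_def by blast
    ultimately have "a * x * b + scl (- 1) * (a * x * b - vert w) \<in> ?S" using S' by blast
    hence "vert w \<in> ?S" by (simp add: scl_minus_one)
    hence wG: "vert w \<in> alg_ideal_gen ?A ?Y" using w YG by blast
    \<comment> \<open>With \<open>vert w\<close> in front, the multiple of \<open>x\<close> lies in
      the ideal generated by \<open>w\<close>; multiplied by \<open>b\<close> it gives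
      \<open>w\<close> again, so it is nonzero.\<close>
    have "vert w * a * x * b = vert w * (a * x * b)" by (simp add: mult.assoc)
    also have "\<dots> \<simeq> vert w * vert w" using w ab by (intro eqv_mult_left) auto
    also have "\<dots> \<simeq> vert w" using w by (intro vert_vert) auto
    finally have "vert w * a * x * b \<notin> T" using w eqv_T by blast
    hence "vert w * a * x \<notin> T" using T_mult_right ab(2) by blast
    then obtain c where c: "c \<in> C" "c * (vert w * a * x) \<simeq> x"
      using Min_T_recover[OF x, of "vert w * a"] w ab by auto
    have "vert w * (a * x) \<in> alg_ideal_gen ?A ?Y" using G' wG free_algebra_mult[OF ab(1) xC] by simp
    hence "c * (vert w * a * x) \<in> alg_ideal_gen ?A ?Y" using G' c(1) by (simp add: mult.assoc)
    moreover have "x - c * (vert w * a * x) \<in> T" using eqv_sym[OF c(2)] by (simp add: eqv_def)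
    hence "x - c * (vert w * a * x) \<in> alg_ideal_gen ?A ?Y" using YG by (meson UnI1 subsetD)
    moreover have "y + z \<in> alg_ideal_gen ?A ?Y"
      if "y \<in> alg_ideal_gen ?A ?Y" "z \<in> alg_ideal_gen ?A ?Y" for y z
      using that G' by simp
    ultimately have "c * (vert w * a * x) + (x - c * (vert w * a * x)) \<in> alg_ideal_gen ?A ?Y"
      by (simp only:)
    thus ?thesis by simp
  qed
  hence "T \<union> Min_T \<subseteq> alg_ideal_gen ?A ?Y" using YG by blast
  hence "alg_sums ?A (T \<union> Min_T) \<subseteq> alg_ideal_gen ?A ?Y"
    by (rule alg_sums_subset_left_ideal[OF alg_ideal_imp_left_ideal[OF G]])
  thus "?S \<subseteq> alg_ideal_gen ?A ?Y" by (simp only: socle_step_def)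
qed

section \<open>Homogeneous generators and the induction along the socle series\<close>

lemma lpa_relators_homogeneous:
  assumes "r \<in> lpa_relators E"
  shows "\<exists>e. \<forall>d. hom_comp d r = (if d = e then r else 0)"
proof -
  have gen: "hom_comp d (free_gen g) = (if d = letter_degree g then free_gen g else 0)"
    and gen2: "hom_comp d (free_gen g * free_gen h) =
      (if d = letter_degree g + letter_degree h then free_gen g * free_gen h else 0)" for d g h
    by (auto simp: free_gen_def mult_single hom_comp_single word_degree_def)
  note simps = hom_comp_diff hom_comp_sum gen gen2
  from assms show ?thesis
  proof cases
    case (vertices v w)
    thus ?thesis by (intro exI[of _ 0]) (simp add: simps)
  next
    case (source_edge e)
    thus ?thesis by (intro exI[of _ 1]) (simp add: simps)
  next
    case (edge_range e)
    thus ?thesis by (intro exI[of _ 1]) (simp add: simps)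
  next
    case (range_ghost e)
    thus ?thesis by (intro exI[of _ "- 1"]) (simp add: simps)
  next
    case (ghost_source e)
    thus ?thesis by (intro exI[of _ "- 1"]) (simp add: simps)
  next
    case (CK1 e f)
    thus ?thesis by (intro exI[of _ 0]) (simp add: simps)
  next
    case (CK2 v)
    thus ?thesis by (intro exI[of _ 0]) (simp add: simps)
  qed
qed

lemma lpa_relators_carrier:
  fixes E :: "('v, 'e) pre_digraph"
  assumes "wf_digraph E"
  shows "lpa_relators E \<subseteq> carrier (free_algebra (lpa_gens E) :: ('k::field, _) nu_algebra)"
proof
  let ?C = "carrier (free_algebra (lpa_gens E) :: ('k, _) nu_algebra)"
  interpret wf_digraph E by fact
  fix r :: "('v, 'e) lpa_gen gen_word \<Rightarrow>\<^sub>0 'k"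
  assume "r \<in> lpa_relators E"
  thus "r \<in> ?C"
    by cases (auto simp: lpa_gens_def free_algebra_zero regular_vertex_def
        intro!: free_algebra_diff free_algebra_sum free_algebra_mult free_algebra_free_gen)
qed

text \<open>The generators are homogeneous. For \<open>X = {}\<close> this gives the relation ideal,
  and for the vertices of a socle term it readies the next step of the induction.\<close>

lemma graded_lpa_quotient_gen:
  assumes E: "row_finite_digraph E" and X: "X \<subseteq> verts E"
  shows "graded_lpa_quotient E (alg_ideal_gen (free_algebra (lpa_gens E))
    (lpa_relators E \<union> (\<lambda>v. free_gen (Vertex v)) ` X
      :: (('v, 'e) lpa_gen gen_word \<Rightarrow>\<^sub>0 'k::field) set))"
    (is "graded_lpa_quotient E (alg_ideal_gen ?A ?Y)")
proof -
  interpret row_finite_digraph E by (rule E)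
  interpret nonunital_algebra ?A by (rule nonunital_algebra_free_algebra)
  have Y: "?Y \<subseteq> carrier ?A"
    using lpa_relators_carrier[OF wf_digraph_axioms] X
    by (auto simp: lpa_gens_def intro!: free_algebra_free_gen)
  have G: "alg_ideal ?A (alg_ideal_gen ?A ?Y)" by (rule alg_ideal_gen_ideal[OF Y])
  have comp: "hom_comp d y = y \<or> hom_comp d y = 0" if "y \<in> ?Y" for y d
    using that
  proof
    assume "y \<in> lpa_relators E"
    thus ?thesis using lpa_relators_homogeneous by metis
  qed (auto simp: free_gen_def hom_comp_single)
  have "0 \<in> alg_ideal_gen ?A ?Y" using G by (simp only: alg_ideal_free_algebra_iff)
  hence "hom_comp d y \<in> alg_ideal_gen ?A ?Y" if "y \<in> ?Y" for y d
    using comp[OF that, of d] subsetD[OF alg_ideal_gen_superset that, of ?A] by (elim disjE) simp_all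
  hence "graded (alg_ideal_gen ?A ?Y)" by (rule graded_alg_ideal_gen[OF Y])
  thus ?thesis using G alg_ideal_gen_superset[of ?Y ?A] by unfold_locales auto
qed

lemma alg_ideal_lpa_relation_ideal:
  assumes "wf_digraph E"
  shows "alg_ideal (free_algebra (lpa_gens E)) (lpa_relation_ideal E)"
  unfolding lpa_relation_ideal_def
  by (rule nonunital_algebra.alg_ideal_gen_ideal[OF nonunital_algebra_free_algebra
        lpa_relators_carrier[OF assms]])

lemma nonunital_algebra_leavitt: "wf_digraph E \<Longrightarrow> nonunital_algebra (leavitt E)"
  unfolding leavitt_def
  by (rule nonunital_algebra.nonunital_algebra_quot[OF nonunital_algebra_free_algebra
        alg_ideal_lpa_relation_ideal])

lemma leavitt_left_unit:
  assumes E: "row_finite_digraph E" and x: "x \<in> carrier (leavitt E)"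
  shows "\<exists>u\<in>carrier (leavitt E). alg_mult (leavitt E) u x = x"
proof -
  interpret row_finite_digraph E by (rule E)
  let ?A = "free_algebra (lpa_gens E)" and ?R = "lpa_relation_ideal E"
  interpret A: nonunital_algebra ?A by (rule nonunital_algebra_free_algebra)
  interpret Q: graded_lpa_quotient E ?R
    using graded_lpa_quotient_gen[OF E, of "{}"] by (simp add: lpa_relation_ideal_def)
  obtain y where y: "y \<in> carrier ?A" "x = alg_coset ?A ?R y"
    using x by (auto simp: leavitt_def A.alg_quot_carrier)
  obtain u where u: "u \<in> carrier ?A" "Q.eqv (u * y) y" using Q.left_unit[OF y(1)] by blast
  have uy: "u * y \<in> carrier ?A" using u y by (auto intro: free_algebra_mult)
  have "u * y - y \<in> ?R" using u(2) by (simp add: Q.eqv_def)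
  hence "u * y \<in> alg_coset ?A ?R y" by (force simp: alg_coset_def)
  hence "alg_coset ?A ?R (u * y) = alg_coset ?A ?R y"
    using A.alg_coset_eq_iff[OF Q.ideal y(1) uy] by simp
  hence "alg_mult (leavitt E) (alg_coset ?A ?R u) x = x"
    using A.alg_quot_mult[OF Q.ideal u(1) y(1)] y(2) by (simp add: leavitt_def)
  thus ?thesis using u(1) by (auto simp: leavitt_def A.alg_quot_carrier)
qed

text \<open>Socle terms are pulled back to the free algebra, where the grading is defined.\<close>

definition socle_preimage ::
    "nat \<Rightarrow> ('v, 'e) pre_digraph \<Rightarrow> (('v, 'e) lpa_gen gen_word \<Rightarrow>\<^sub>0 'k::field) set" where
  "socle_preimage n E = {x \<in> carrier (free_algebra (lpa_gens E)).
     alg_coset (free_algebra (lpa_gens E)) (lpa_relation_ideal E) x \<in> socle_series (leavitt E) n}"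

text \<open>The generated form in the induction hypothesis yields gradedness of the present term,
  under which \<open>socle_step_vertices\<close> determines the next one.\<close>

lemma socle_preimage_eq:
  assumes E: "row_finite_digraph E"
  shows "(socle_preimage n E :: (('v, 'e) lpa_gen gen_word \<Rightarrow>\<^sub>0 'k::field) set) =
    alg_ideal_gen (free_algebra (lpa_gens E))
      (lpa_relators E \<union> (\<lambda>v. free_gen (Vertex v)) ` socle_points TYPE('k) n E)"
proof (induction n)
  interpret row_finite_digraph E by (rule E)
  let ?A = "free_algebra (lpa_gens E) :: ('k, ('v, 'e) lpa_gen gen_word \<Rightarrow>\<^sub>0 'k) nu_algebra"
  let ?R = "lpa_relation_ideal E :: (('v, 'e) lpa_gen gen_word \<Rightarrow>\<^sub>0 'k) set"
  let ?L = "leavitt E :: ('k, ('k, 'v, 'e) lpa_elem) nu_algebra"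
  interpret A: nonunital_algebra ?A by (rule nonunital_algebra_free_algebra)
  note R = alg_ideal_lpa_relation_ideal[OF wf_digraph_axioms, where 'c = 'k]
  let ?V = "\<lambda>n. socle_points TYPE('k) n E"
  have V: "?V n \<subseteq> verts E" for n by (auto simp: socle_points_def)
  let ?g = "\<lambda>v. free_gen (Vertex v) :: ('v, 'e) lpa_gen gen_word \<Rightarrow>\<^sub>0 'k"
  have gC: "?g v \<in> carrier ?A" if "v \<in> verts E" for v
    using that by (auto simp: lpa_gens_def intro!: free_algebra_free_gen)
  have points: "v \<in> ?V n \<longleftrightarrow> ?g v \<in> socle_preimage n E" if "v \<in> verts E" for v n
    using that gC by (auto simp: socle_points_def socle_preimage_def lpa_vertex_def)
  let ?Y = "\<lambda>n. lpa_relators E \<union> ?g ` ?V n"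
  {
    case 0
    have "socle_preimage 0 E = ?R"
      using A.alg_coset_eq_zero_iff[OF R] R
      by (auto simp: socle_preimage_def leavitt_def A.alg_quot_zero alg_ideal_iff)
    moreover have "?R = alg_ideal_gen ?A (?Y 0)"
    proof
      have "?g ` ?V 0 \<subseteq> ?R" using points V calculation by blast
      thus "alg_ideal_gen ?A (?Y 0) \<subseteq> ?R"
        using alg_ideal_gen_superset[of "lpa_relators E" ?A]
        by (intro alg_ideal_gen_least[OF R]) (auto simp: lpa_relation_ideal_def)
      show "?R \<subseteq> alg_ideal_gen ?A (?Y 0)"
        unfolding lpa_relation_ideal_def alg_ideal_gen_def by blast
    qed
    ultimately show ?case by simp
  next
    case (Suc n)
    let ?T = "socle_preimage n E :: (('v, 'e) lpa_gen gen_word \<Rightarrow>\<^sub>0 'k) set"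
    let ?T' = "socle_preimage (Suc n) E :: (('v, 'e) lpa_gen gen_word \<Rightarrow>\<^sub>0 'k) set"
    interpret Q: graded_lpa_quotient E ?T
      unfolding Suc by (rule graded_lpa_quotient_gen[OF E V])
    note L = nonunital_algebra_leavitt[OF wf_digraph_axioms, where 'c = 'k]
    have S: "alg_ideal ?L (socle_series ?L n)"
      "socle_series ?L (Suc n) = socle_step ?L (socle_series ?L n)"
      using socle_series_Suc[OF L leavitt_left_unit[OF E]] by auto
    have epi: "ring_epi ?A ?L (alg_coset ?A ?R)"
      unfolding leavitt_def by (rule A.ring_epi_coset[OF R])
    \<comment> \<open>The coset map pulls the step in the Leavitt path algebra back to a step in the
      free algebra.\<close>
    have T': "?T' = socle_step ?A ?T"
      using socle_step_preimage[OF A.nonunital_algebra_axioms L epi S(1)]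
      by (simp only: socle_preimage_def S(2))
    have "?g ` {v \<in> verts E. ?g v \<in> ?T'} = ?g ` ?V (Suc n)" using points V by blast
    hence "?T' = alg_ideal_gen ?A (?T \<union> ?g ` ?V (Suc n))"
      using Q.socle_step_vertices unfolding T'[symmetric] by simp
    \<comment> \<open>Among the generators, \<open>?T\<close> may be traded for relators: by
      hypothesis it is generated by them and by earlier vertices, which belong to the later
      ones.\<close>
    also have "\<dots> = alg_ideal_gen ?A (?Y (Suc n))"
    proof
      have YC: "?Y (Suc n) \<subseteq> carrier ?A"
        using lpa_relators_carrier[OF wf_digraph_axioms, where 'k = 'k] gC V by blast
      have TC: "?T \<union> ?g ` ?V (Suc n) \<subseteq> carrier ?A" using YC Q.T_C by blast
      have "?T \<subseteq> ?T'" unfolding T' using A.socle_step_superset[OF Q.ideal] by blast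
      hence "?V n \<subseteq> ?V (Suc n)" using points V by blast
      hence "alg_ideal_gen ?A (?Y n) \<subseteq> alg_ideal_gen ?A (?Y (Suc n))"
        unfolding alg_ideal_gen_def by blast
      hence "?T \<union> ?g ` ?V (Suc n) \<subseteq> alg_ideal_gen ?A (?Y (Suc n))"
        using Suc alg_ideal_gen_superset[of "?Y (Suc n)" ?A] by blast
      thus "alg_ideal_gen ?A (?T \<union> ?g ` ?V (Suc n)) \<subseteq> alg_ideal_gen ?A (?Y (Suc n))"
        by (rule alg_ideal_gen_least[OF A.alg_ideal_gen_ideal[OF YC]])
      have "?Y (Suc n) \<subseteq> ?T \<union> ?g ` ?V (Suc n)" using Q.relators by blast
      thus "alg_ideal_gen ?A (?Y (Suc n)) \<subseteq> alg_ideal_gen ?A (?T \<union> ?g ` ?V (Suc n))"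
        unfolding alg_ideal_gen_def by blast
    qed
    finally show ?case .
  }
qed

text \<open>For the harder inclusion, the vertex ideal is pulled back along the linear coset map.
  The result is an ideal containing the relators and the chosen vertices, hence the whole of
  \<open>socle_preimage\<close>.\<close>

theorem socle_series_eq_vertex_ideal:
  assumes E: "row_finite_digraph E"
  shows "vertex_ideal E (socle_points TYPE('k) n E) =
    socle_series (leavitt E :: ('k::field, ('k, 'v, 'e) lpa_elem) nu_algebra) n"
proof
  interpret row_finite_digraph E by (rule E)
  let ?A = "free_algebra (lpa_gens E) :: ('k, ('v, 'e) lpa_gen gen_word \<Rightarrow>\<^sub>0 'k) nu_algebra"
  let ?R = "lpa_relation_ideal E :: (('v, 'e) lpa_gen gen_word \<Rightarrow>\<^sub>0 'k) set"
  let ?L = "leavitt E :: ('k, ('k, 'v, 'e) lpa_elem) nu_algebra"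
  let ?V = "socle_points TYPE('k) n E" and ?\<phi> = "alg_coset ?A ?R"
  interpret A: nonunital_algebra ?A by (rule nonunital_algebra_free_algebra)
  note R = alg_ideal_lpa_relation_ideal[OF wf_digraph_axioms, where 'c = 'k]
  interpret L: nonunital_algebra ?L by (rule nonunital_algebra_leavitt[OF wf_digraph_axioms])
  have epi: "ring_epi ?A ?L ?\<phi>" unfolding leavitt_def by (rule A.ring_epi_coset[OF R])
  have S: "alg_ideal ?L (socle_series ?L n)"
    using socle_series_Suc[OF L.nonunital_algebra_axioms leavitt_left_unit[OF E]] by blast
  have vS: "lpa_vertex E ` ?V \<subseteq> socle_series ?L n" by (auto simp: socle_points_def)
  thus "vertex_ideal E ?V \<subseteq> socle_series ?L n"
    unfolding vertex_ideal_def by (rule alg_ideal_gen_least[OF S])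
  have SC: "socle_series ?L n \<subseteq> carrier ?L" using S by (simp add: alg_ideal_iff)
  have I: "alg_ideal ?L (vertex_ideal E ?V)"
    unfolding vertex_ideal_def by (rule L.alg_ideal_gen_ideal) (use vS SC in blast)
  have "alg_ideal ?A {x \<in> carrier ?A. ?\<phi> x \<in> vertex_ideal E ?V}" (is "alg_ideal ?A ?I")
    by (rule alg_ideal_preimage[OF A.nonunital_algebra_axioms L.nonunital_algebra_axioms epi _ I])
      (simp only: leavitt_def A.alg_quot_smult[OF R])
  moreover have "r \<in> ?I" if r: "r \<in> lpa_relators E" for r
  proof -
    have "r \<in> ?R" unfolding lpa_relation_ideal_def by (rule subsetD[OF alg_ideal_gen_superset r])
    moreover have rC: "r \<in> carrier ?A" using r lpa_relators_carrier[OF wf_digraph_axioms] by blast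
    ultimately have "?\<phi> r = alg_zero ?L"
      using A.alg_coset_eq_zero_iff[OF R rC] by (simp add: leavitt_def A.alg_quot_zero)
    thus ?thesis using rC I by (simp add: alg_ideal_iff)
  qed
  moreover have "free_gen (Vertex v) \<in> ?I" if v: "v \<in> ?V" for v
  proof -
    have "v \<in> verts E" using v by (simp add: socle_points_def)
    hence "free_gen (Vertex v) \<in> carrier ?A" by (auto simp: lpa_gens_def intro!: free_algebra_free_gen)
    moreover have "?\<phi> (free_gen (Vertex v)) \<in> vertex_ideal E ?V"
      using v alg_ideal_gen_superset[of "lpa_vertex E ` ?V" ?L]
      unfolding vertex_ideal_def lpa_vertex_def by blast
    ultimately show ?thesis by blast
  qed
  ultimately have "socle_preimage n E \<subseteq> ?I"
    unfolding socle_preimage_eq[OF E] by (intro alg_ideal_gen_least) auto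
  hence "?\<phi> x \<in> vertex_ideal E ?V" if "x \<in> carrier ?A" "?\<phi> x \<in> socle_series ?L n" for x
    using that unfolding socle_preimage_def by blast
  moreover have "carrier ?L = ?\<phi> ` carrier ?A" using epi by (simp add: ring_epi_def)
  ultimately show "socle_series ?L n \<subseteq> vertex_ideal E ?V"
    using SC by (auto simp: subset_iff image_iff)
qed

section \<open>Invariance under ring isomorphism\<close>

text \<open>The induction hypothesis identifies the image with a socle term of \<open>B\<close>,
  hence with an ideal, as \<open>ring_iso_socle_step\<close> demands.\<close>

lemma ring_iso_socle_series:
  assumes A: "nonunital_algebra A" and B: "nonunital_algebra B"
    and uA: "\<And>x. x \<in> carrier A \<Longrightarrow> \<exists>u\<in>carrier A. alg_mult A u x = x"
    and uB: "\<And>x. x \<in> carrier B \<Longrightarrow> \<exists>u\<in>carrier B. alg_mult B u x = x"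
    and f: "f \<in> alg_ring_iso A B"
  shows "f ` socle_series A n = socle_series B n"
proof (induction n)
  case 0
  have "ring_epi A B f" using f by (auto simp: alg_ring_iso_def ring_epi_def bij_betw_def)
  thus ?case using ring_epi_zero[OF A B] by simp
next
  case (Suc n)
  have "socle_series A n \<subseteq> carrier A"
    using socle_series_Suc[OF A uA] by (simp add: alg_ideal_iff)
  thus ?case
    using ring_iso_socle_step[OF A B f, of "socle_series A n"]
      socle_series_Suc[OF A uA, of n] socle_series_Suc[OF B uB, of n] Suc by simp
qed

theorem proposition4p1:
  fixes E :: "('v, 'e) pre_digraph"
    and F :: "('w, 'd) pre_digraph"
    and f :: "('k::field, 'v, 'e) lpa_elem \<Rightarrow> ('k, 'w, 'd) lpa_elem"
    and n :: nat
  assumes "row_finite_digraph E"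
    and "row_finite_digraph F"
    and "n \<ge> 1"
    and "f \<in> alg_ring_iso (leavitt E) (leavitt F)"
  shows "f ` vertex_ideal E (socle_points TYPE('k) n E)
         = vertex_ideal F (socle_points TYPE('k) n F)"
  unfolding socle_series_eq_vertex_ideal[OF assms(1)] socle_series_eq_vertex_ideal[OF assms(2)]
proof (rule ring_iso_socle_series[OF _ _ _ _ assms(4)])
  show "nonunital_algebra (leavitt E :: ('k, ('k, 'v, 'e) lpa_elem) nu_algebra)"
    using assms(1) by (intro nonunital_algebra_leavitt) (simp add: row_finite_digraph_def)
  show "nonunital_algebra (leavitt F :: ('k, ('k, 'w, 'd) lpa_elem) nu_algebra)"
    using assms(2) by (intro nonunital_algebra_leavitt) (simp add: row_finite_digraph_def)
qed (fact leavitt_left_unit[OF assms(1)] leavitt_left_unit[OF assms(2)])+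

end
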